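(* (Exact solution of Fermi's two-atom problem in waveguide QED, and its causality.) Let $J_0>0$, $\Omega>0$, $L>0$, and consider two identical qubits, labelled $-1$ and $1$, at $x_{-1}=-L/2$ and $x_1=L/2$. The single-excitation time evolution for $t>0$ with initial state $|\psi(0)\rangle=|e_{-1}\rangle$ (qubit $-1$ excited, qubit $1$ in its ground state, no photon) is given by $$e_{-1}(t)=\sum_{n=0}^\infty\frac{(\tau_n^{(1)}J_0)^{2n}}{(2n)!}e^{-(J_0+i\Omega)\tau_n^{(1)}}\Theta(\tau_n^{(1)}),\qquad e_1(t)=-\sum_{n=0}^\infty\frac{(\tau_n^{(2)}J_0)^{2n+1}}{(2n+1)!}e^{-(J_0+i\Omega)\tau_n^{(2)}}\Theta(\tau_n^{(2)}),$$ $$\psi_R(x,t)=i\sqrt{J_0}\sum_{n=0}^\infty\Big[\frac{(\tau_n^{(4)}J_0)^{2n}}{(2n+1)!}\big(\tau_n^{(4)}J_0-(2n+1)\big)e^{-(J_0+i\Omega)\tau_n^{(4)}}\Theta(x-\tfrac L2)\Theta(\tau_n^{(4)})-\frac{(\tau_n^{(3)}J_0)^{2n}}{(2n)!}e^{-(J_0+i\Omega)\tau_n^{(3)}}\Pi_L(x)\Theta(\tau_n^{(3)})\Big],$$ $$\psi_L(x,t)=i\sqrt{J_0}\sum_{n=0}^\infty\Big[\frac{(\tau_n^{(5)}J_0)^{2n+1}}{(2n+1)!}e^{-(J_0+i\Omega)\tau_n^{(5)}}\Pi_L(x)\Theta(\tau_n^{(5)})-\frac{(\tau_n^{(6)}J_0)^{2n-1}}{(2n)!}\big(\tau_n^{(6)}J_0-2n\big)e^{-(J_0+i\Omega)\tau_n^{(6)}}\Theta(-x-\tfrac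 L2)\Theta(\tau_n^{(6)})\Big],$$ where $$\tau_n^{(1)}=t-2nL,\quad \tau_n^{(2)}=t-(2n+1)L,\quad \tau_n^{(3)}=t-2nL-(x+\tfrac L2),$$ $$\tau_n^{(4)}=t-(2n+1)L-(x-\tfrac L2),\quad \tau_n^{(5)}=t-(2n+1)L+(x-\tfrac L2),\quad \tau_n^{(6)}=t-2nL+(x+\tfrac L2).$$ That is, these amplitudes satisfy the initial condition and, for $t>0$, the equations $$i(\partial_t-\partial_x)\psi_L=\sqrt{J_0}\sum_{Q=\pm1}e_Q(t)\delta(x-x_Q),\qquad i(\partial_t+\partial_x)\psi_R=\sqrt{J_0}\sum_{Q=\pm1}e_Q(t)\delta(x-x_Q),$$ $$(i\partial_t-\Omega)e_Q(t)=\sqrt{J_0}\,\psi(x_Q,t),\quad Q=\pm1,\qquad \psi=\psi_R+\psi_L.$$ In particular causality is respected: $e_1(t)=0$ for $0\le t\le L$.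
   Context: Units are $\hbar=v_g=1$. A single-excitation state is $|\psi(t)\rangle=\int dx\,[\psi_L(x,t)C_L^\dagger(x)+\psi_R(x,t)C_R^\dagger(x)]|0\rangle+\sum_Q e_Q(t)|e_Q\rangle$, where $C_{R/L}^\dagger(x)$ create right/left-moving photons and $|e_Q\rangle$ is the state with qubit $Q$ excited and no photon. For the real-space point-coupling Hamiltonian with qubit energy $\Omega$ and single-emitter decay rate $\gamma_0=2J_0$, the Schrödinger equation $i\partial_t|\psi\rangle=H|\psi\rangle$ is equivalent to the displayed equations for $\psi_L,\psi_R,e_{\pm1}$. The field equations are understood in the sense of distributions on $\mathbb R\times(0,\infty)$, and the qubit equations for almost every $t>0$ (the $e_Q$ being continuous for $t>0$). $\psi(x_Q,t)$ is the common value of the left and right limits of $\psi_R+\psi_L$ at $x_Q$ (the individual components may jump there, their sum does not). $\Theta$ is the Heaviside function and $\Pi_L(x)=\Theta(x+L/2)-\Theta(x-L/2)$. For each $(x,t)$ only finitely many terms of each sum are non-zero. The $n=0$ term with prefactor $(\tau_0^{(6)}J_0)^{-1}(\tau_0^{(6)}J_0)$ is read as $1$, and $0^0=1$. *)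

theory Defs
  imports "HOL-Analysis.Analysis"
begin

section \<open>Distributions on the half plane\<close>

text \<open>
  Space-time points are pairs \<open>(x, t)\<close>.  A map between Euclidean spaces is of class
  \<open>C\<^sup>k\<^sup>+\<^sup>1\<close> iff it is differentiable and all its directional derivatives are of class \<open>C\<^sup>k\<close>.
\<close>

primrec C_k :: "nat \<Rightarrow> ('a::euclidean_space \<Rightarrow> 'b::euclidean_space) \<Rightarrow> bool" where
  "C_k 0 f \<longleftrightarrow> continuous_on UNIV f"
| "C_k (Suc k) f \<longleftrightarrow>
     (\<forall>p. f differentiable (at p)) \<and> (\<forall>v. C_k k (\<lambda>p. frechet_derivative f (at p) v))"

definition smooth :: "('a::euclidean_space \<Rightarrow> 'b::euclidean_space) \<Rightarrow> bool" where
  "smooth f \<longleftrightarrow> (\<forall>k. C_k k f)"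

definition half_plane :: "(real \<times> real) set" where
  "half_plane = UNIV \<times> {0<..}"

definition test_functions :: "(real \<times> real \<Rightarrow> complex) set" where
  "test_functions = {\<phi>. smooth \<phi> \<and> compact (closure {p. \<phi> p \<noteq> 0}) \<and>
                         closure {p. \<phi> p \<noteq> 0} \<subseteq> half_plane}"

type_synonym functional = "(real \<times> real \<Rightarrow> complex) \<Rightarrow> complex"

definition locally_integrable :: "(real \<Rightarrow> real \<Rightarrow> complex) \<Rightarrow> bool" where
  "locally_integrable f \<longleftrightarrow>
     (\<forall>K. compact K \<longrightarrow> K \<subseteq> half_plane \<longrightarrow> set_integrable lborel K (\<lambda>(x, t). f x t))"

definition regular_distr :: "(real \<Rightarrow> real \<Rightarrow> complex) \<Rightarrow> functional" where
  "regular_distr f \<phi> = (LINT p:half_plane|lborel. f (fst p) (snd p) * \<phi> p)"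

definition D_x :: "functional \<Rightarrow> functional" where
  "D_x T \<phi> = - T (\<lambda>p. frechet_derivative \<phi> (at p) (1, 0))"

definition D_t :: "functional \<Rightarrow> functional" where
  "D_t T \<phi> = - T (\<lambda>p. frechet_derivative \<phi> (at p) (0, 1))"

text \<open>The distribution \<open>g(t) \<delta>(x - a)\<close>.\<close>

definition delta_source :: "real \<Rightarrow> (real \<Rightarrow> complex) \<Rightarrow> functional" where
  "delta_source a g \<phi> = (LINT t:{0<..}|lborel. g t * \<phi> (a, t))"


section \<open>The single-excitation Schroedinger equation\<close>

text \<open>
  The qubits are labelled by the integers \<open>-1\<close> and \<open>1\<close>; only these two values of an amplitude
  family \<open>e\<close> matter.
\<close>

definition qubit_pos :: "real \<Rightarrow> int \<Rightarrow> real" where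
  "qubit_pos L Q = of_int Q * L / 2"

definition field_equation_L ::
  "real \<Rightarrow> real \<Rightarrow> (int \<Rightarrow> real \<Rightarrow> complex) \<Rightarrow> (real \<Rightarrow> real \<Rightarrow> complex) \<Rightarrow> bool" where
  "field_equation_L J0 L e \<psi>L \<longleftrightarrow> locally_integrable \<psi>L \<and>
     (\<forall>\<phi>\<in>test_functions.
        \<i> * (D_t (regular_distr \<psi>L) \<phi> - D_x (regular_distr \<psi>L) \<phi>)
        = of_real (sqrt J0) * (\<Sum>Q\<in>{-1, 1}. delta_source (qubit_pos L Q) (e Q) \<phi>))"

definition field_equation_R ::
  "real \<Rightarrow> real \<Rightarrow> (int \<Rightarrow> real \<Rightarrow> complex) \<Rightarrow> (real \<Rightarrow> real \<Rightarrow> complex) \<Rightarrow> bool" where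
  "field_equation_R J0 L e \<psi>R \<longleftrightarrow> locally_integrable \<psi>R \<and>
     (\<forall>\<phi>\<in>test_functions.
        \<i> * (D_t (regular_distr \<psi>R) \<phi> + D_x (regular_distr \<psi>R) \<phi>)
        = of_real (sqrt J0) * (\<Sum>Q\<in>{-1, 1}. delta_source (qubit_pos L Q) (e Q) \<phi>))"

text \<open>
  The value of a field at a point where it may be undefined or assigned an arbitrary value: the
  common value of its one-sided limits.
\<close>

definition has_point_value :: "(real \<Rightarrow> complex) \<Rightarrow> real \<Rightarrow> complex \<Rightarrow> bool" where
  "has_point_value f a v \<longleftrightarrow> (f \<longlongrightarrow> v) (at_left a) \<and> (f \<longlongrightarrow> v) (at_right a)"

definition qubit_equation ::
  "real \<Rightarrow> real \<Rightarrow> real \<Rightarrow> (int \<Rightarrow> real \<Rightarrow> complex) \<Rightarrow>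
   (real \<Rightarrow> real \<Rightarrow> complex) \<Rightarrow> (real \<Rightarrow> real \<Rightarrow> complex) \<Rightarrow> int \<Rightarrow> bool" where
  "qubit_equation J0 \<Omega> L e \<psi>L \<psi>R Q \<longleftrightarrow> continuous_on {0<..} (e Q) \<and>
     (AE t in lborel. t > 0 \<longrightarrow>
        (\<exists>e' v. (e Q has_vector_derivative e') (at t) \<and>
                has_point_value (\<lambda>x. \<psi>R x t + \<psi>L x t) (qubit_pos L Q) v \<and>
                \<i> * e' - of_real \<Omega> * e Q t = of_real (sqrt J0) * v))"

text \<open>
  The squared distance of the state with amplitudes \<open>\<psi>L\<close>, \<open>\<psi>R\<close>, \<open>e\<close> at time \<open>t\<close> from the state with
  qubit \<open>P\<close> excited and no photon.
\<close>

definition dist2_excited ::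
  "int \<Rightarrow> (int \<Rightarrow> real \<Rightarrow> complex) \<Rightarrow> (real \<Rightarrow> real \<Rightarrow> complex) \<Rightarrow>
   (real \<Rightarrow> real \<Rightarrow> complex) \<Rightarrow> real \<Rightarrow> ennreal" where
  "dist2_excited P e \<psi>L \<psi>R t =
     (\<integral>\<^sup>+x. ennreal ((cmod (\<psi>L x t))\<^sup>2 + (cmod (\<psi>R x t))\<^sup>2) \<partial>lborel)
     + ennreal (\<Sum>Q\<in>{-1, 1}. (cmod (e Q t - (if Q = P then 1 else 0)))\<^sup>2)"

text \<open>
  The state at time \<open>0\<close> is the given one, and it is attained continuously.  The latter is what
  ties the initial state to the equations, which are imposed for \<open>t > 0\<close> only.
\<close>

definition initially_excited ::
  "int \<Rightarrow> (int \<Rightarrow> real \<Rightarrow> complex) \<Rightarrow> (real \<Rightarrow> real \<Rightarrow> complex) \<Rightarrow>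
   (real \<Rightarrow> real \<Rightarrow> complex) \<Rightarrow> bool" where
  "initially_excited P e \<psi>L \<psi>R \<longleftrightarrow>
     (\<forall>Q\<in>{-1, 1}. e Q 0 = (if Q = P then 1 else 0)) \<and>
     (AE x in lborel. \<psi>L x 0 = 0 \<and> \<psi>R x 0 = 0) \<and>
     (dist2_excited P e \<psi>L \<psi>R \<longlongrightarrow> 0) (at_right 0)"


section \<open>The explicit amplitudes\<close>

text \<open>
  With \<open>\<Theta>(0) = 1\<close> the formulas below also have the right values at \<open>t = 0\<close>.  All series have only
  finitely many non-zero terms.
\<close>

definition Theta :: "real \<Rightarrow> real" where
  "Theta s = (if s \<ge> 0 then 1 else 0)"

definition Pi_box :: "real \<Rightarrow> real \<Rightarrow> real" where
  "Pi_box L x = Theta (x + L / 2) - Theta (x - L / 2)"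

definition tau1 :: "real \<Rightarrow> nat \<Rightarrow> real \<Rightarrow> real" where
  "tau1 L n t = t - 2 * real n * L"

definition tau2 :: "real \<Rightarrow> nat \<Rightarrow> real \<Rightarrow> real" where
  "tau2 L n t = t - (2 * real n + 1) * L"

definition tau3 :: "real \<Rightarrow> nat \<Rightarrow> real \<Rightarrow> real \<Rightarrow> real" where
  "tau3 L n x t = t - 2 * real n * L - (x + L / 2)"

definition tau4 :: "real \<Rightarrow> nat \<Rightarrow> real \<Rightarrow> real \<Rightarrow> real" where
  "tau4 L n x t = t - (2 * real n + 1) * L - (x - L / 2)"

definition tau5 :: "real \<Rightarrow> nat \<Rightarrow> real \<Rightarrow> real \<Rightarrow> real" where
  "tau5 L n x t = t - (2 * real n + 1) * L + (x - L / 2)"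

definition tau6 :: "real \<Rightarrow> nat \<Rightarrow> real \<Rightarrow> real \<Rightarrow> real" where
  "tau6 L n x t = t - 2 * real n * L + (x + L / 2)"

definition damped_phase :: "real \<Rightarrow> real \<Rightarrow> real \<Rightarrow> complex" where
  "damped_phase J0 \<Omega> s = exp (- (of_real J0 + \<i> * of_real \<Omega>) * of_real s)"

definition e_minus :: "real \<Rightarrow> real \<Rightarrow> real \<Rightarrow> real \<Rightarrow> complex" where
  "e_minus J0 \<Omega> L t =
     (\<Sum>n. let \<tau> = tau1 L n t in
        of_real ((\<tau> * J0) ^ (2 * n) / fact (2 * n)) * damped_phase J0 \<Omega> \<tau> * of_real (Theta \<tau>))"

definition e_plus :: "real \<Rightarrow> real \<Rightarrow> real \<Rightarrow> real \<Rightarrow> complex" where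
  "e_plus J0 \<Omega> L t =
     - (\<Sum>n. let \<tau> = tau2 L n t in
        of_real ((\<tau> * J0) ^ (2 * n + 1) / fact (2 * n + 1)) * damped_phase J0 \<Omega> \<tau>
        * of_real (Theta \<tau>))"

definition e_amp :: "real \<Rightarrow> real \<Rightarrow> real \<Rightarrow> int \<Rightarrow> real \<Rightarrow> complex" where
  "e_amp J0 \<Omega> L Q = (if Q = -1 then e_minus J0 \<Omega> L else if Q = 1 then e_plus J0 \<Omega> L else (\<lambda>t. 0))"

definition psi_R :: "real \<Rightarrow> real \<Rightarrow> real \<Rightarrow> real \<Rightarrow> real \<Rightarrow> complex" where
  "psi_R J0 \<Omega> L x t = \<i> * of_real (sqrt J0) *
     (\<Sum>n. let \<tau>3 = tau3 L n x t; \<tau>4 = tau4 L n x t in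
        of_real ((\<tau>4 * J0) ^ (2 * n) / fact (2 * n + 1) * (\<tau>4 * J0 - (2 * real n + 1)))
          * damped_phase J0 \<Omega> \<tau>4 * of_real (Theta (x - L / 2) * Theta \<tau>4)
        - of_real ((\<tau>3 * J0) ^ (2 * n) / fact (2 * n))
          * damped_phase J0 \<Omega> \<tau>3 * of_real (Pi_box L x * Theta \<tau>3))"

text \<open>
  In the last term, \<open>(\<tau>J0)\<^sup>-\<^sup>1 (\<tau>J0)\<close>, which occurs for \<open>n = 0\<close>, is read as \<open>1\<close> (also for \<open>\<tau> = 0\<close>).
\<close>

definition psi_L :: "real \<Rightarrow> real \<Rightarrow> real \<Rightarrow> real \<Rightarrow> real \<Rightarrow> complex" where
  "psi_L J0 \<Omega> L x t = \<i> * of_real (sqrt J0) *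
     (\<Sum>n. let \<tau>5 = tau5 L n x t; \<tau>6 = tau6 L n x t in
        of_real ((\<tau>5 * J0) ^ (2 * n + 1) / fact (2 * n + 1))
          * damped_phase J0 \<Omega> \<tau>5 * of_real (Pi_box L x * Theta \<tau>5)
        - of_real (if n = 0 then 1
                   else (\<tau>6 * J0) ^ (2 * n - 1) / fact (2 * n) * (\<tau>6 * J0 - 2 * real n))
          * damped_phase J0 \<Omega> \<tau>6 * of_real (Theta (- x - L / 2) * Theta \<tau>6))"

end

theory Submission
  imports Defs
begin

text \<open>
  Each field is what the two qubits emit: with \<open>\<sigma> = 1\<close> for right movers and \<open>\<sigma> = -1\<close> for left movers,
  \<open>\<psi> = -\<i> \<surd>J\<^sub>0 (\<Sum>\<^sub>Q e\<^sub>Q(t - \<sigma> (x - x\<^sub>Q)) \<Theta>(\<sigma> (x - x\<^sub>Q)))\<close>.  Such a retarded wave solves the transport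
  equation with source \<open>e\<^sub>Q(t) \<delta>(x - x\<^sub>Q)\<close>, and inserting it into the qubit equations leaves the
  delay equation \<open>e\<^sub>Q'(t) = -(J\<^sub>0 + \<i>\<Omega>) e\<^sub>Q(t) - J\<^sub>0 e\<^sub>-\<^sub>Q(t - L)\<close>.  Both amplitudes are sums of the modes
  \<open>(s J\<^sub>0)\<^sup>m / m! exp (-(J\<^sub>0 + \<i>\<Omega>) s) \<Theta>(s)\<close> at \<open>s = t - mL\<close>, over even and over odd \<open>m\<close>; differentiation lowers
  \<open>m\<close> by one, which is exactly the delayed coupling.
\<close>

section \<open>Echo sums and their delay equations\<close>

lemma Theta_measurable [measurable]: "Theta \<in> borel_measurable borel"
  unfolding Theta_def by measurable

lemma damped_phase_measurable [measurable]:
  "damped_phase J0 \<Omega> \<in> borel_measurable borel"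
  unfolding damped_phase_def by (intro borel_measurable_continuous_onI continuous_intros)

lemma norm_damped_phase: "norm (damped_phase J0 \<Omega> s) = exp (- J0 * s)"
  by (simp add: damped_phase_def)

section \<open>Modes with a fixed number of crossings\<close>

text \<open>The index \<open>m\<close> counts the crossings from one qubit to the other. With
  \<open>Theta\<close> built in, a mode is a function on the whole line, and series of shifted modes
  need no side condition on time.\<close>

definition mode :: "real \<Rightarrow> real \<Rightarrow> nat \<Rightarrow> real \<Rightarrow> complex" where
  "mode J0 \<Omega> m s =
     of_real ((s * J0) ^ m / fact m) * damped_phase J0 \<Omega> s * of_real (Theta s)"

lemma mode_neg: "s < 0 \<Longrightarrow> mode J0 \<Omega> m s = 0"
  by (simp add: mode_def Theta_def)

lemma mode_at_0: "mode J0 \<Omega> m 0 = (if m = 0 then 1 else 0)"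
  by (simp add: mode_def Theta_def damped_phase_def)

lemma mode_measurable [measurable]: "mode J0 \<Omega> m \<in> borel_measurable borel"
  unfolding mode_def by measurable

text \<open>Dropping the damping factor leaves a term of the exponential series of
  \<open>T * J0\<close>, so sums of modes are bounded independently of their length.\<close>

lemma norm_mode_le:
  assumes "J0 > 0" and "s \<le> T" and "T \<ge> 0"
  shows "norm (mode J0 \<Omega> m s) \<le> (T * J0) ^ m / fact m"
proof (cases "s \<ge> 0")
  case True
  have "norm (mode J0 \<Omega> m s) = (s * J0) ^ m / fact m * exp (- J0 * s)"
    using True assms by (simp add: mode_def Theta_def norm_mult norm_damped_phase norm_power norm_divide)
  also have "\<dots> \<le> (s * J0) ^ m / fact m * 1"
    using True assms by (intro mult_left_mono) auto
  also have "\<dots> \<le> (T * J0) ^ m / fact m"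
    using True assms by (auto intro!: divide_right_mono power_mono mult_right_mono)
  finally show ?thesis .
qed (use assms in \<open>simp add: mode_neg\<close>)

lemma continuous_mode:
  assumes "m \<ge> 1"
  shows "continuous_on UNIV (mode J0 \<Omega> m)"
proof -
  \<comment> \<open>The power vanishes at 0, so the cutoff can move inside it as
    \<open>max s 0\<close>; for \<open>m = 0\<close> this fails because
    \<open>0 ^ 0 = 1\<close>.\<close>
  have eq: "mode J0 \<Omega> m = (\<lambda>s. of_real ((max s 0 * J0) ^ m / fact m) * damped_phase J0 \<Omega> s)"
    using assms by (auto simp: mode_def Theta_def max_def)
  show ?thesis
    unfolding eq damped_phase_def by (intro continuous_intros) auto
qed

lemma isCont_mode:
  assumes "m \<ge> 1 \<or> s \<noteq> 0"
  shows "isCont (mode J0 \<Omega> m) s"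
proof (cases "m \<ge> 1")
  case True
  then show ?thesis
    using continuous_mode continuous_on_eq_continuous_at by blast
next
  case False
  then have m: "m = 0" and "s \<noteq> 0"
    using assms by auto
  have ev: "\<forall>\<^sub>F u in nhds s. mode J0 \<Omega> m u = of_real (Theta s) * damped_phase J0 \<Omega> u"
  proof (cases "s > 0")
    case True
    then show ?thesis
      using eventually_nhds_in_open[of "{0<..}" s]
      by (auto simp: mode_def Theta_def m elim!: eventually_mono)
  next
    case False
    with \<open>s \<noteq> 0\<close> show ?thesis
      using eventually_nhds_in_open[of "{..<0}" s]
      by (auto simp: mode_def Theta_def m elim!: eventually_mono)
  qed
  have "isCont (\<lambda>u. of_real (Theta s) * damped_phase J0 \<Omega> u) s"
    unfolding damped_phase_def by (intro continuous_intros)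
  then show ?thesis
    using isCont_cong[OF ev] by simp
qed

text \<open>Product rule for \<open>s > 0\<close>, the zero function for \<open>s < 0\<close>. At 0
  the mode jumps for \<open>m = 0\<close> and, if \<open>J0\<close> is non-zero, has a kink for
  \<open>m = 1\<close>.\<close>

lemma mode_has_vector_derivative:
  assumes "s \<noteq> 0"
  shows "(mode J0 \<Omega> m has_vector_derivative
    (if m = 0 then 0 else of_real J0 * mode J0 \<Omega> (m - 1) s)
      - (of_real J0 + \<i> * of_real \<Omega>) * mode J0 \<Omega> m s) (at s)"
proof (cases "s > 0")
  case True
  define c where "c = of_real J0 + \<i> * of_real \<Omega>"
  have "((\<lambda>u. of_real ((u * J0) ^ m / fact m) * exp (- c * of_real u)) has_vector_derivative
     (if m = 0 then 0 else of_real (J0 * ((s * J0) ^ (m - 1) / fact (m - 1)))) * exp (- c * of_real s)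
     - c * (of_real ((s * J0) ^ m / fact m) * exp (- c * of_real s))) (at s)"
  proof -
    have 1: "((\<lambda>u. (u * J0) ^ m / fact m) has_real_derivative
       (if m = 0 then 0 else J0 * ((s * J0) ^ (m - 1) / fact (m - 1)))) (at s)"
    proof (cases m)
      case (Suc k)
      have "((\<lambda>u. (u * J0) ^ Suc k / fact (Suc k)) has_real_derivative
          real (Suc k) * (s * J0) ^ k * J0 / fact (Suc k)) (at s)"
        by (rule derivative_eq_intros refl | simp)+
      moreover have "real (Suc k) * y * J0 / fact (Suc k) = J0 * (y / fact k)" for y
        by (simp add: divide_simps del: of_nat_Suc)
      ultimately show ?thesis by (simp add: Suc del: power_Suc fact_Suc of_nat_Suc)
    qed simp
    have 2: "((\<lambda>u. exp (- c * of_real u)) has_vector_derivative - c * exp (- c * of_real s)) (at s)"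
      by (rule derivative_eq_intros has_vector_derivative_real_field | simp)+
    show ?thesis
      using has_vector_derivative_mult[OF has_vector_derivative_of_real[OF 1] 2]
      by (cases m) (simp_all add: algebra_simps)
  qed
  then show ?thesis
    unfolding c_def
    by (rule has_vector_derivative_transform_within_open[of _ _ _ "{0<..}", THEN has_vector_derivative_eq_rhs])
       (use True in \<open>auto simp: mode_def Theta_def damped_phase_def algebra_simps\<close>)
next
  case False
  then have "s < 0" using assms by simp
  have "((\<lambda>_. 0) has_vector_derivative 0) (at s)" by simp
  then have "(mode J0 \<Omega> m has_vector_derivative 0) (at s)"
    by (rule has_vector_derivative_transform_within_open[of _ _ _ "{..<0}"])
       (use \<open>s < 0\<close> in \<open>auto simp: mode_neg\<close>)
  then show ?thesis using \<open>s < 0\<close> by (cases "m = 0") (simp_all add: mode_neg)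
qed

section \<open>Echo sums: locally finite series of modes\<close>

text \<open>\<open>p\<close> is the parity of the number of crossings: 0 for qubit -1, 1 for qubit
  1. The sign of the odd amplitude stays outside.\<close>

definition echo_sum :: "real \<Rightarrow> real \<Rightarrow> real \<Rightarrow> nat \<Rightarrow> real \<Rightarrow> complex" where
  "echo_sum J0 \<Omega> L p t = (\<Sum>n. mode J0 \<Omega> (2 * n + p) (t - real (2 * n + p) * L))"

lemma e_minus_eq: "e_minus J0 \<Omega> L t = echo_sum J0 \<Omega> L 0 t"
  by (simp add: e_minus_def echo_sum_def mode_def tau1_def Let_def)

lemma e_plus_eq: "e_plus J0 \<Omega> L t = - echo_sum J0 \<Omega> L 1 t"
  by (simp add: e_plus_def echo_sum_def mode_def tau2_def Let_def add.commute)

lemma echo_sum_measurable [measurable]: "echo_sum J0 \<Omega> L p \<in> borel_measurable borel"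
  unfolding echo_sum_def by measurable

lemma echo_terms_vanish:
  assumes "L > 0" and "t < real (2 * N + p) * L" and "n \<ge> N"
  shows "mode J0 \<Omega> (2 * n + p) (t - real (2 * n + p) * L) = 0"
proof (rule mode_neg)
  have "real (2 * N + p) * L \<le> real (2 * n + p) * L"
    using assms by (intro mult_right_mono) auto
  then show "t - real (2 * n + p) * L < 0" using assms by linarith
qed

lemma echo_cutoff:
  fixes L :: real
  assumes "L > 0"
  obtains N where "t < real (2 * N + p) * L"
proof -
  obtain N :: nat where "t / L < real N" using reals_Archimedean2 by blast
  then have "t < real N * L" using assms by (simp add: divide_simps)
  also have "\<dots> \<le> real (2 * N + p) * L" using assms by (intro mult_right_mono) auto
  finally show ?thesis using that by blast
qed

text \<open>Each crossing takes time \<open>L\<close>, so late terms have not started. The bound on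
  \<open>t\<close> is an open condition: one \<open>N\<close> serves a whole neighbourhood, which
  allows continuity and derivatives term by term.\<close>

lemma echo_sum_finite:
  assumes "L > 0" and "t < real (2 * N + p) * L"
  shows "echo_sum J0 \<Omega> L p t = (\<Sum>n<N. mode J0 \<Omega> (2 * n + p) (t - real (2 * n + p) * L))"
  unfolding echo_sum_def
  by (rule suminf_finite) (use echo_terms_vanish[OF assms] in auto)

lemma echo_sum_sums:
  assumes "L > 0"
  shows "(\<lambda>n. mode J0 \<Omega> (2 * n + p) (t - real (2 * n + p) * L)) sums echo_sum J0 \<Omega> L p t"
proof -
  obtain N where N: "t < real (2 * N + p) * L" by (rule echo_cutoff[OF assms])
  show ?thesis
    unfolding echo_sum_finite[OF assms N]
    by (rule sums_finite) (use echo_terms_vanish[OF assms N] in auto)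
qed

lemma echo_sum_eq_0:
  assumes "L > 0" and "t < real p * L"
  shows "echo_sum J0 \<Omega> L p t = 0"
  using echo_sum_finite[of L t 0 p] assms by simp

lemma echo_sum_at_start:
  assumes "L > 0"
  shows "echo_sum J0 \<Omega> L p (real p * L) = (if p = 0 then 1 else 0)"
  using echo_sum_finite[of L "real p * L" 1 p] assms by (simp add: mode_at_0)

lemma norm_echo_sum_le:
  assumes "J0 > 0" and "L > 0" and "t \<le> T" and "T \<ge> 0"
  shows "norm (echo_sum J0 \<Omega> L p t) \<le> exp (T * J0)"
proof -
  obtain N where N: "t < real (2 * N + p) * L" by (rule echo_cutoff[OF assms(2)])
  have "norm (echo_sum J0 \<Omega> L p t) \<le> (\<Sum>n<N. (T * J0) ^ (2 * n + p) / fact (2 * n + p))"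
    unfolding echo_sum_finite[OF assms(2) N]
  proof (rule sum_norm_le, rule norm_mode_le)
    fix n
    have "real (2 * n + p) * L \<ge> 0" using assms by simp
    then show "t - real (2 * n + p) * L \<le> T" using assms by linarith
  qed (use assms in auto)
  \<comment> \<open>The indices \<open>2 * n + p\<close> are distinct, so this is a sum over a
    finite subset of the exponential series.\<close>
  also have "\<dots> = (\<Sum>m\<in>(\<lambda>n. 2 * n + p) ` {..<N}. (T * J0) ^ m / fact m)"
    by (subst sum.reindex) (auto simp: inj_on_def)
  also have "\<dots> = (\<Sum>m\<in>(\<lambda>n. 2 * n + p) ` {..<N}. inverse (fact m) * (T * J0) ^ m)"
    by (simp add: field_simps)
  also have "\<dots> \<le> (\<Sum>m. inverse (fact m) * (T * J0) ^ m)"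
    using assms by (intro sum_le_suminf summable_exp) auto
  also have "\<dots> = exp (T * J0)" by (simp add: exp_def scaleR_conv_of_real field_simps)
  finally show ?thesis .
qed

text \<open>Only the mode of index 0 jumps, and it occurs only for \<open>p = 0\<close>, starting at
  time 0.\<close>

lemma isCont_echo_sum:
  assumes "L > 0" and "p = 0 \<Longrightarrow> t \<noteq> 0"
  shows "isCont (echo_sum J0 \<Omega> L p) t"
proof -
  obtain N where N: "t < real (2 * N + p) * L" by (rule echo_cutoff[OF assms(1)])
  have ev: "\<forall>\<^sub>F u in nhds t. echo_sum J0 \<Omega> L p u =
      (\<Sum>n<N. mode J0 \<Omega> (2 * n + p) (u - real (2 * n + p) * L))"
    using eventually_nhds_in_open[of "{..<real (2 * N + p) * L}" t] N
    by (auto simp: echo_sum_finite[OF assms(1)] elim!: eventually_mono)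
  have "isCont (\<lambda>u. \<Sum>n<N. mode J0 \<Omega> (2 * n + p) (u - real (2 * n + p) * L)) t"
    by (intro continuous_intros isCont_o2[OF _ isCont_mode])
       (use assms in auto)
  then show ?thesis using isCont_cong[OF ev] by simp
qed

text \<open>Modes start at multiples of \<open>L\<close>. The coupling series is left unevaluated
  because lowering the index acts differently on the two parities.\<close>

lemma echo_sum_has_vector_derivative:
  assumes "L > 0" and nodes: "\<And>k. t \<noteq> real k * L"
  shows "(echo_sum J0 \<Omega> L p has_vector_derivative
     (\<Sum>n. if 2 * n + p = 0 then 0
           else of_real J0 * mode J0 \<Omega> (2 * n + p - 1) (t - real (2 * n + p) * L))
      - (of_real J0 + \<i> * of_real \<Omega>) * echo_sum J0 \<Omega> L p t) (at t)"
proof -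
  obtain N where N: "t < real (2 * N + p) * L" by (rule echo_cutoff[OF assms(1)])
  let ?c = "of_real J0 + \<i> * of_real \<Omega>"
  let ?s = "\<lambda>n t. t - real (2 * n + p) * L"
  have van: "?s n t < 0" if "n \<ge> N" for n
  proof -
    have "real (2 * N + p) * L \<le> real (2 * n + p) * L"
      using that assms by (intro mult_right_mono) auto
    with N show ?thesis by linarith
  qed
  have "((\<lambda>u. mode J0 \<Omega> (2 * n + p) (?s n u)) has_vector_derivative
      (if 2 * n + p = 0 then 0 else of_real J0 * mode J0 \<Omega> (2 * n + p - 1) (?s n t))
        - ?c * mode J0 \<Omega> (2 * n + p) (?s n t)) (at t)" for n
  proof -
    have 1: "(?s n has_vector_derivative 1) (at t)"
      by (auto intro!: derivative_eq_intros)
    have 2: "?s n t \<noteq> 0" using nodes[of "2 * n + p"] by simp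
    show ?thesis
      using vector_diff_chain_at[OF 1 mode_has_vector_derivative[OF 2, of J0 \<Omega> "2 * n + p"]]
      by (simp only: o_def scaleR_one)
  qed
  then have "((\<lambda>u. \<Sum>n<N. mode J0 \<Omega> (2 * n + p) (?s n u)) has_vector_derivative
      (\<Sum>n<N. (if 2 * n + p = 0 then 0 else of_real J0 * mode J0 \<Omega> (2 * n + p - 1) (?s n t))
        - ?c * mode J0 \<Omega> (2 * n + p) (?s n t))) (at t)"
    by (intro has_vector_derivative_sum)
  moreover have "(\<Sum>n. if 2 * n + p = 0 then 0 else of_real J0 * mode J0 \<Omega> (2 * n + p - 1) (?s n t))
    = (\<Sum>n<N. if 2 * n + p = 0 then 0 else of_real J0 * mode J0 \<Omega> (2 * n + p - 1) (?s n t))"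
    by (rule suminf_finite) (use van in \<open>auto simp: mode_neg not_less\<close>)
  ultimately have "((\<lambda>u. \<Sum>n<N. mode J0 \<Omega> (2 * n + p) (?s n u)) has_vector_derivative
     (\<Sum>n. if 2 * n + p = 0 then 0 else of_real J0 * mode J0 \<Omega> (2 * n + p - 1) (?s n t))
      - ?c * echo_sum J0 \<Omega> L p t) (at t)"
    by (simp only: echo_sum_finite[OF assms(1) N] sum_subtractf sum_distrib_left)
  then show ?thesis
    by (rule has_vector_derivative_transform_within_open[of _ _ _ "{..<real (2 * N + p) * L}"])
       (use N in \<open>auto simp: echo_sum_finite[OF assms(1)]\<close>)
qed

text \<open>Lowering sends \<open>2 * n\<close> to the odd index \<open>2 * (n - 1) + 1\<close>, and
  one delay is absorbed into \<open>t - L\<close>. The term \<open>n = 0\<close> contributes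
  nothing, so the series match after an index shift.\<close>

lemma echo_sum_delay_0:
  assumes "L > 0" and nodes: "\<And>k. t \<noteq> real k * L"
  shows "(echo_sum J0 \<Omega> L 0 has_vector_derivative
     of_real J0 * echo_sum J0 \<Omega> L 1 (t - L)
      - (of_real J0 + \<i> * of_real \<Omega>) * echo_sum J0 \<Omega> L 0 t) (at t)"
proof -
  have "(\<lambda>n. of_real J0 * mode J0 \<Omega> (2 * n + 1) (t - L - real (2 * n + 1) * L)) sums
      (of_real J0 * echo_sum J0 \<Omega> L 1 (t - L))"
    by (intro sums_mult echo_sum_sums assms)
  also have "(\<lambda>n. of_real J0 * mode J0 \<Omega> (2 * n + 1) (t - L - real (2 * n + 1) * L)) =
    (\<lambda>n. if 2 * Suc n + 0 = 0 then 0
           else of_real J0 * mode J0 \<Omega> (2 * Suc n + 0 - 1) (t - real (2 * Suc n + 0) * L))"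
    by (simp add: algebra_simps)
  finally have "(\<lambda>n. if 2 * n + 0 = 0 then 0
           else of_real J0 * mode J0 \<Omega> (2 * n + 0 - 1) (t - real (2 * n + 0) * L)) sums
      (of_real J0 * echo_sum J0 \<Omega> L 1 (t - L))"
    by (subst (asm) sums_Suc_iff) simp
  from sums_unique[OF this] echo_sum_has_vector_derivative[OF assms, of _ _ 0] show ?thesis
    by simp
qed

text \<open>Here \<open>2 * n + 1\<close> is lowered to \<open>2 * n\<close>: the series match term
  by term without a shift.\<close>

lemma echo_sum_delay_1:
  assumes "L > 0" and nodes: "\<And>k. t \<noteq> real k * L"
  shows "(echo_sum J0 \<Omega> L 1 has_vector_derivative
     of_real J0 * echo_sum J0 \<Omega> L 0 (t - L)
      - (of_real J0 + \<i> * of_real \<Omega>) * echo_sum J0 \<Omega> L 1 t) (at t)"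
proof -
  have "(\<lambda>n. of_real J0 * mode J0 \<Omega> (2 * n + 0) (t - L - real (2 * n + 0) * L)) sums
      (of_real J0 * echo_sum J0 \<Omega> L 0 (t - L))"
    by (intro sums_mult echo_sum_sums assms)
  also have "(\<lambda>n. of_real J0 * mode J0 \<Omega> (2 * n + 0) (t - L - real (2 * n + 0) * L)) =
    (\<lambda>n. if 2 * n + 1 = 0 then 0
           else of_real J0 * mode J0 \<Omega> (2 * n + 1 - 1) (t - real (2 * n + 1) * L))"
    by (simp add: algebra_simps)
  finally have "(\<lambda>n. if 2 * n + 1 = 0 then 0
           else of_real J0 * mode J0 \<Omega> (2 * n + 1 - 1) (t - real (2 * n + 1) * L)) sums
      (of_real J0 * echo_sum J0 \<Omega> L 0 (t - L))" .
  from sums_unique[OF this] echo_sum_has_vector_derivative[OF assms, of J0 \<Omega> 1] show ?thesis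
    by (simp only:)
qed

section \<open>Retarded waves as distributional solutions\<close>

lemma integrable_compact_support:
  fixes f :: "real \<times> real \<Rightarrow> complex"
  assumes "f \<in> borel_measurable borel" and "compact K"
    and "\<And>p. p \<in> K \<Longrightarrow> norm (f p) \<le> B" and "\<And>p. p \<notin> K \<Longrightarrow> f p = 0"
  shows "integrable lborel f"
proof (rule integrableI_bounded_set[of K _ _ B])
  show "K \<in> sets lborel" using assms(2) by (simp add: borel_compact)
  show "emeasure lborel K < \<infinity>"
    using emeasure_bounded_finite[OF compact_imp_bounded[OF assms(2)]] by (simp add: less_top)
qed (use assms in auto)

text \<open>Weaker than continuity, because \<open>e_minus\<close> jumps at time 0; with
  measurability it suffices for integrability on compact sets.\<close>

definition locally_bounded :: "(real \<Rightarrow> complex) \<Rightarrow> bool" where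
  "locally_bounded g \<longleftrightarrow> (\<forall>T. \<exists>B. \<forall>s. \<bar>s\<bar> \<le> T \<longrightarrow> norm (g s) \<le> B)"

text \<open>The field radiated from \<open>a\<close> by a source \<open>g\<close>, evaluated at the
  retarded time; \<open>\<sigma>\<close> is the direction of motion. A start at time 0 is encoded in
  \<open>g\<close> vanishing before.\<close>

definition wave :: "real \<Rightarrow> real \<Rightarrow> (real \<Rightarrow> complex) \<Rightarrow> real \<Rightarrow> real \<Rightarrow> complex" where
  "wave \<sigma> a g x t = g (t - \<sigma> * (x - a)) * of_real (Theta (\<sigma> * (x - a)))"

lemma wave_measurable [measurable]:
  assumes [measurable]: "g \<in> borel_measurable borel"
  shows "(\<lambda>p. wave \<sigma> a g (fst p) (snd p)) \<in> borel_measurable (borel :: (real \<times> real) measure)"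
  unfolding wave_def borel_prod[symmetric] by measurable

lemma wave_bounded_on_compact:
  assumes "locally_bounded g" and "compact K" and "\<bar>\<sigma>\<bar> = 1"
  obtains B where "\<And>p. p \<in> K \<Longrightarrow> norm (wave \<sigma> a g (fst p) (snd p)) \<le> B"
proof -
  obtain R where R: "\<And>p. p \<in> K \<Longrightarrow> norm p \<le> R"
    using compact_imp_bounded[OF assms(2)] by (auto simp: bounded_iff)
  obtain B where B: "\<And>s. \<bar>s\<bar> \<le> 2 * R + \<bar>a\<bar> \<Longrightarrow> norm (g s) \<le> B"
    using assms(1) unfolding locally_bounded_def by blast
  show ?thesis
  proof (rule that)
    fix p assume "p \<in> K"
    then have "\<bar>fst p\<bar> \<le> R" "\<bar>snd p\<bar> \<le> R"
      using R[of p] norm_fst_le[of "fst p" "snd p"] norm_snd_le[of "snd p" "fst p"] by auto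
    moreover have "\<bar>snd p - \<sigma> * (fst p - a)\<bar> \<le> \<bar>snd p\<bar> + \<bar>\<sigma> * (fst p - a)\<bar>" by simp
    moreover have "\<bar>\<sigma> * (fst p - a)\<bar> \<le> \<bar>fst p\<bar> + \<bar>a\<bar>" using assms(3) by (simp add: abs_mult)
    ultimately have "norm (g (snd p - \<sigma> * (fst p - a))) \<le> B" by (intro B) linarith
    then show "norm (wave \<sigma> a g (fst p) (snd p)) \<le> max B 0"
      by (auto simp: wave_def Theta_def)
  qed
qed

lemma wave_times_integrable:
  assumes "locally_bounded g" and [measurable]: "g \<in> borel_measurable borel"
    and "compact K" and "\<bar>\<sigma>\<bar> = 1"
    and cont: "continuous_on UNIV \<phi>" and supp: "\<And>p. p \<notin> K \<Longrightarrow> \<phi> p = 0"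
  shows "integrable lborel (\<lambda>p. wave \<sigma> a g (fst p) (snd p) * \<phi> p)"
proof -
  obtain B where B: "\<And>p. p \<in> K \<Longrightarrow> norm (wave \<sigma> a g (fst p) (snd p)) \<le> B"
    by (rule wave_bounded_on_compact[OF assms(1,3,4)]) blast
  have "compact (\<phi> ` K)"
    using cont assms(3) compact_continuous_image continuous_on_subset by blast
  then obtain C where C: "\<And>p. p \<in> K \<Longrightarrow> norm (\<phi> p) \<le> C"
    using compact_imp_bounded by (fastforce simp: bounded_iff)
  have [measurable]: "\<phi> \<in> borel_measurable borel"
    using cont by (rule borel_measurable_continuous_onI)
  show ?thesis
  proof (rule integrable_compact_support[OF _ assms(3)])
    show "norm (wave \<sigma> a g (fst p) (snd p) * \<phi> p) \<le> max B 0 * C" if "p \<in> K" for p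
      unfolding norm_mult using B[OF that] C[OF that] by (intro mult_mono) auto
  qed (use supp in auto)
qed

section \<open>Test functions and integration along characteristics\<close>

lemma smooth_has_derivative:
  assumes "smooth \<phi>"
  shows "(\<phi> has_derivative frechet_derivative \<phi> (at p)) (at p)"
  using assms frechet_derivative_works unfolding smooth_def by (metis C_k.simps(2))

lemma smooth_continuous_derivative:
  "smooth \<phi> \<Longrightarrow> continuous_on UNIV (\<lambda>p. frechet_derivative \<phi> (at p) v)"
  unfolding smooth_def by (metis C_k.simps)

lemma derivative_outside_support:
  assumes "p \<notin> closure {p. \<phi> p \<noteq> 0}"
  shows "frechet_derivative \<phi> (at p) v = 0"
proof -
  have "(\<phi> has_derivative (\<lambda>_. 0)) (at p)"
    by (rule has_derivative_transform_within_open[of "\<lambda>_. 0" _ _ _ "- closure {p. \<phi> p \<noteq> 0}"])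
       (use assms closure_subset[of "{p. \<phi> p \<noteq> 0}"] in auto)
  from frechet_derivative_at[OF this] show ?thesis by metis
qed

text \<open>The fundamental theorem of calculus on a half line: the primitive vanishes far out, so
  only the end point 0 contributes.\<close>

lemma integral_along_ray:
  fixes F f :: "real \<Rightarrow> complex"
  assumes deriv: "\<And>y. (F has_vector_derivative f y) (at y)"
    and cont: "continuous_on UNIV f"
    and supp: "\<And>y. \<bar>y\<bar> \<ge> M \<Longrightarrow> F y = 0" "\<And>y. \<bar>y\<bar> \<ge> M \<Longrightarrow> f y = 0"
  shows "(LINT y|lborel. of_real (Theta y) * f y) = - F 0"
proof -
  define N where "N = max M 0"
  have "(LINT y|lborel. of_real (Theta y) * f y) = (LINT y|lborel. indicator {0..N} y *\<^sub>R f y)"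
    by (intro Bochner_Integration.integral_cong)
       (auto simp: Theta_def N_def supp indicator_def)
  also have "\<dots> = F N - F 0"
  proof (rule integral_FTC_Icc)
    show "0 \<le> N" by (simp add: N_def)
    show "(F has_vector_derivative f x) (at x within {0..N})" for x
      using deriv by (rule has_vector_derivative_at_within)
    show "continuous_on {0..N} f" using cont by (rule continuous_on_subset) simp
  qed
  also have "F N = 0" by (intro supp) (auto simp: N_def)
  finally show ?thesis by simp
qed

text \<open>Along the characteristics \<open>t - \<sigma> (x - a) = s\<close> the operator \<open>\<partial>\<^sub>t + \<sigma> \<partial>\<^sub>x\<close> is a total
  derivative, so integrating over the ray emanating from \<open>(a, s)\<close> leaves the boundary value there.\<close>

lemma integral_wave_transport:
  assumes \<phi>: "smooth \<phi>" "compact (closure {p. \<phi> p \<noteq> 0})"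
    and g: "locally_bounded g" "g \<in> borel_measurable borel" and \<sigma>: "\<bar>\<sigma>\<bar> = 1"
  shows "(LINT p|lborel. wave \<sigma> a g (fst p) (snd p) * frechet_derivative \<phi> (at p) (\<sigma>, 1))
       = - (LINT s|lborel. g s * \<phi> (a, s))"
proof -
  note [measurable] = g(2)
  define K where "K = closure {p. \<phi> p \<noteq> 0}"
  define D where "D p = frechet_derivative \<phi> (at p) (\<sigma>, 1)" for p
  have contD: "continuous_on UNIV D"
    unfolding D_def by (rule smooth_continuous_derivative[OF \<phi>(1)])
  have [measurable]: "D \<in> borel_measurable borel"
    using contD by (rule borel_measurable_continuous_onI)
  have D_out: "D p = 0" if "p \<notin> K" for p
    using that derivative_outside_support unfolding D_def K_def by blast
  have \<phi>_out: "\<phi> p = 0" if "p \<notin> K" for p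
    using that closure_subset[of "{p. \<phi> p \<noteq> 0}"] unfolding K_def by auto
  obtain R where R: "\<And>p. p \<in> K \<Longrightarrow> norm p \<le> R"
    using compact_imp_bounded[OF \<phi>(2)] by (auto simp: bounded_iff K_def)
  have far: "p \<notin> K" if "\<bar>fst p\<bar> > R \<or> \<bar>snd p\<bar> > R" for p
    using R[of p] norm_fst_le[of "fst p" "snd p"] norm_snd_le[of "snd p" "fst p"] that by auto
  have \<sigma>\<sigma>: "\<sigma> * \<sigma> = 1" and \<sigma>0: "\<sigma> \<noteq> 0" using \<sigma> by (auto simp: abs_if split: if_splits)
  have \<sigma>\<sigma>y: "\<sigma> * (\<sigma> * y) = y" for y using \<sigma>\<sigma> by (simp add: mult.assoc[symmetric])
  \<comment> \<open>The integrand in characteristic coordinates: \<open>s\<close> is the emission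
    time and \<open>y\<close> the distance travelled, so \<open>x = a + \<sigma> * y\<close> and
    \<open>t = s + y\<close>, with Jacobian of modulus 1.\<close>
  define H where "H y s = of_real (Theta y) * (g s * D (a + \<sigma> * y, s + y))" for y s
  have H_meas: "(\<lambda>p. H (fst p) (snd p)) \<in> borel_measurable borel"
  proof -
    have [measurable]: "fst \<in> borel_measurable (borel :: (real \<times> real) measure)"
      "snd \<in> borel_measurable (borel :: (real \<times> real) measure)"
      by (intro borel_measurable_continuous_onI continuous_intros)+
    have [measurable]: "(\<lambda>p. D (a + \<sigma> * fst p, snd p + fst p)) \<in> borel_measurable borel"
      by (intro borel_measurable_continuous_onI continuous_on_compose2[OF contD] continuous_intros) auto
    show ?thesis unfolding H_def
      by measurable
  qed
  obtain B where B: "\<And>s. \<bar>s\<bar> \<le> 2 * R + \<bar>a\<bar> \<Longrightarrow> norm (g s) \<le> B"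
    using g(1) unfolding locally_bounded_def by blast
  have "compact (D ` K)"
    using contD \<phi>(2) compact_continuous_image continuous_on_subset unfolding K_def by blast
  then obtain C where C: "\<And>p. p \<in> K \<Longrightarrow> norm (D p) \<le> C"
    using compact_imp_bounded by (fastforce simp: bounded_iff)
  \<comment> \<open>Compact support in \<open>(x, t)\<close> becomes containment in a bounded
    rectangle in \<open>(y, s)\<close>, which gives the integrability of \<open>H\<close> needed to
    exchange integrals.\<close>
  have H_near: "\<bar>y\<bar> \<le> R + \<bar>a\<bar> \<and> \<bar>s\<bar> \<le> 2 * R + \<bar>a\<bar>" if "(a + \<sigma> * y, s + y) \<in> K" for y s
  proof -
    have "\<bar>a + \<sigma> * y\<bar> \<le> R" "\<bar>s + y\<bar> \<le> R"
      using far[of "(a + \<sigma> * y, s + y)"] that by force+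
    moreover have "\<bar>\<sigma> * y\<bar> = \<bar>y\<bar>" using \<sigma> by (simp add: abs_mult)
    ultimately show ?thesis by linarith
  qed
  have H_int: "integrable lborel (\<lambda>p. H (fst p) (snd p))"
  proof (rule integrable_compact_support[OF H_meas])
    let ?Q = "{- (R + \<bar>a\<bar>)..R + \<bar>a\<bar>} \<times> {- (2 * R + \<bar>a\<bar>)..2 * R + \<bar>a\<bar>}"
    show "compact ?Q" by (intro compact_Times compact_Icc)
    show "norm (H (fst p) (snd p)) \<le> max B 0 * max C 0" if "p \<in> ?Q" for p
    proof (cases "(a + \<sigma> * fst p, snd p + fst p) \<in> K")
      case True
      have "norm (g (snd p)) \<le> max B 0"
        using B[of "snd p"] that by (auto simp: mem_Times_iff abs_le_iff)
      moreover have "norm (D (a + \<sigma> * fst p, snd p + fst p)) \<le> max C 0"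
        using C[OF True] by simp
      ultimately have "norm (g (snd p) * D (a + \<sigma> * fst p, snd p + fst p)) \<le> max B 0 * max C 0"
        unfolding norm_mult by (intro mult_mono) auto
      then show ?thesis by (auto simp: H_def Theta_def)
    qed (simp add: H_def D_out)
    show "H (fst p) (snd p) = 0" if "p \<notin> ?Q" for p
    proof -
      have "(a + \<sigma> * fst p, snd p + fst p) \<notin> K"
        using that H_near[of "fst p" "snd p"] by (force simp: mem_Times_iff abs_le_iff)
      then show ?thesis by (simp add: H_def D_out)
    qed
  qed
  have W_int: "integrable lborel (\<lambda>p. wave \<sigma> a g (fst p) (snd p) * D p)"
    by (rule wave_times_integrable[OF g(1,2) \<phi>(2) \<sigma> contD]) (use D_out K_def in blast)
  \<comment> \<open>Instead of a planar change of variables: Fubini, an affine substitution in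
    \<open>x\<close>, a translation in \<open>t\<close> for fixed \<open>y\<close>, and Fubini
    again.\<close>
  have "(LINT p|lborel. wave \<sigma> a g (fst p) (snd p) * D p)
      = (LINT x|lborel. LINT t|lborel. wave \<sigma> a g x t * D (x, t))"
    using lborel_pair.integral_fst'[of "\<lambda>p. wave \<sigma> a g (fst p) (snd p) * D p"] W_int
    by (simp add: lborel_prod)
  also have "\<dots> = (LINT y|lborel. LINT t|lborel. wave \<sigma> a g (a + \<sigma> * y) t * D (a + \<sigma> * y, t))"
    by (subst lborel_integral_real_affine[OF \<sigma>0, of _ a]) (simp add: \<sigma>)
  also have "\<dots> = (LINT y|lborel. LINT s|lborel. H y s)"
  proof (rule Bochner_Integration.integral_cong[OF refl])
    fix y
hen     show "(LINT t|lborel. wave \<sigma> a g (a + \<sigma> * y) t * D (a + \<sigma> * y, t)) = (LINT s|lborel. H y s)"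
      by (subst lborel_integral_real_affine[of 1 _ y]) (simp_all add: wave_def H_def[abs_def] \<sigma>\<sigma>y ac_simps)
  qed
  also have "\<dots> = (LINT s|lborel. LINT y|lborel. H y s)"
    using lborel_pair.Fubini_integral[of H] H_int
    by (simp add: lborel_prod case_prod_beta')
  also have "\<dots> = (LINT s|lborel. g s * - \<phi> (a, s))"
  proof (rule Bochner_Integration.integral_cong[OF refl])
    fix s
    let ?c = "\<lambda>y. (a + \<sigma> * y, s + y)"
    have "(LINT y|lborel. of_real (Theta y) * D (?c y)) = - \<phi> (?c 0)"
    proof (rule integral_along_ray)
      fix y
      have "(?c has_vector_derivative (\<sigma>, 1)) (at y)"
        by (auto intro!: derivative_eq_intros has_vector_derivative_Pair)
      then show "((\<lambda>y. \<phi> (?c y)) has_vector_derivative D (?c y)) (at y)"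
        using vector_derivative_diff_chain_within[of ?c "(\<sigma>, 1)" y UNIV \<phi>]
          smooth_has_derivative[OF \<phi>(1), THEN has_derivative_at_withinI]
        by (auto simp: o_def D_def)
    next
      show "continuous_on UNIV (\<lambda>y. D (?c y))"
        by (intro continuous_on_compose2[OF contD] continuous_intros) auto
    next
      \<comment> \<open>The extra 1 exceeds the bound of \<open>H_near\<close> strictly, so the
        point is off the support.\<close>
      fix y assume "R + \<bar>a\<bar> + 1 \<le> \<bar>y\<bar>"
      then have "?c y \<notin> K" using H_near[of y s] by auto
      then show "\<phi> (?c y) = 0" "D (?c y) = 0" using \<phi>_out D_out by auto
    qed
    moreover have "(LINT y|lborel. H y s) = g s * (LINT y|lborel. of_real (Theta y) * D (?c y))"
      unfolding H_def by (subst integral_mult_right_zero[symmetric]) (simp add: ac_simps)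
    ultimately show "(LINT y|lborel. H y s) = g s * - \<phi> (a, s)" by simp
  qed
  finally show ?thesis by (simp add: D_def)
qed

section \<open>The field equation for a superposition of two waves\<close>

lemma AE_fst_noteq: "AE p in (lborel :: (real \<times> real) measure). fst p \<noteq> b"
proof (rule AE_I)
  show "{p \<in> space lborel. \<not> fst p \<noteq> b} \<subseteq> {b} \<times> UNIV" by auto
  have "emeasure (lborel \<Otimes>\<^sub>M lborel) ({b} \<times> (UNIV :: real set)) = 0"
    by (subst lborel.emeasure_pair_measure_Times) auto
  then show "emeasure lborel ({b} \<times> (UNIV :: real set)) = 0" by (simp add: lborel_prod)
qed (simp add: borel_closed closed_Times)

text \<open>The superposition is only required off the lines \<open>x = a1\<close> and \<open>x = a2\<close>, where the explicit
  fields take values depending on the convention for \<open>\<Theta>(0)\<close>.\<close>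

lemma emitted_field_equation:
  fixes c :: complex
  assumes \<sigma>: "\<bar>\<sigma>\<bar> = 1"
    and g1: "locally_bounded g1" "g1 \<in> borel_measurable borel"
    and g2: "locally_bounded g2" "g2 \<in> borel_measurable borel"
    and meas: "(\<lambda>p. \<psi> (fst p) (snd p)) \<in> borel_measurable (borel :: (real \<times> real) measure)"
    and \<psi>: "\<And>x t. x \<noteq> a1 \<Longrightarrow> x \<noteq> a2 \<Longrightarrow> \<psi> x t = c * (wave \<sigma> a1 g1 x t + wave \<sigma> a2 g2 x t)"
  shows "locally_integrable \<psi>"
    and "\<phi> \<in> test_functions \<Longrightarrow>
      D_t (regular_distr \<psi>) \<phi> + of_real \<sigma> * D_x (regular_distr \<psi>) \<phi>
        = c * (delta_source a1 g1 \<phi> + delta_source a2 g2 \<phi>)"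
proof -
  note [measurable] = g1(2) g2(2) meas
  have ae: "AE p in lborel. \<psi> (fst p) (snd p)
      = c * (wave \<sigma> a1 g1 (fst p) (snd p) + wave \<sigma> a2 g2 (fst p) (snd p))"
    using AE_fst_noteq[of a1] AE_fst_noteq[of a2] by eventually_elim (rule \<psi>)
  show "locally_integrable \<psi>"
    unfolding locally_integrable_def
  proof (intro allI impI)
    fix K :: "(real \<times> real) set" assume K: "compact K"
    obtain B1 where B1: "\<And>p. p \<in> K \<Longrightarrow> norm (wave \<sigma> a1 g1 (fst p) (snd p)) \<le> B1"
      by (rule wave_bounded_on_compact[OF g1(1) K \<sigma>]) blast
    obtain B2 where B2: "\<And>p. p \<in> K \<Longrightarrow> norm (wave \<sigma> a2 g2 (fst p) (snd p)) \<le> B2"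
      by (rule wave_bounded_on_compact[OF g2(1) K \<sigma>]) blast
    have bnd: "AE p in lborel. p \<in> K \<longrightarrow> norm (\<psi> (fst p) (snd p)) \<le> norm c * (B1 + B2)"
      using ae
    proof eventually_elim
      case (elim p)
      show ?case
      proof
        assume "p \<in> K"
        have "norm (wave \<sigma> a1 g1 (fst p) (snd p) + wave \<sigma> a2 g2 (fst p) (snd p)) \<le> B1 + B2"
          using B1[OF \<open>p \<in> K\<close>] B2[OF \<open>p \<in> K\<close>] norm_triangle_mono by blast
        then show "norm (\<psi> (fst p) (snd p)) \<le> norm c * (B1 + B2)"
          unfolding elim norm_mult by (intro mult_left_mono) auto
      qed
    qed
    have "integrable lborel (\<lambda>p. indicator K p *\<^sub>R \<psi> (fst p) (snd p))"
      by (rule integrableI_bounded_set_indicator[OF _ _ _ bnd])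
         (use emeasure_bounded_finite[OF compact_imp_bounded[OF K]] in
           \<open>auto simp: borel_compact[OF K] less_top\<close>)
    then show "set_integrable lborel K (\<lambda>(x, t). \<psi> x t)"
      unfolding set_integrable_def by (simp add: case_prod_beta')
  qed

  assume \<phi>: "\<phi> \<in> test_functions"
  define K where "K = closure {p. \<phi> p \<noteq> 0}"
  have sm: "smooth \<phi>" and K: "compact K" and hp: "K \<subseteq> half_plane"
    using \<phi> by (auto simp: test_functions_def K_def)
  define I where "I a g v = (LINT p|lborel. wave \<sigma> a g (fst p) (snd p) * frechet_derivative \<phi> (at p) v)"
    for a g and v :: "real \<times> real"
  have out: "frechet_derivative \<phi> (at p) v = 0" if "p \<notin> K" for p v
    using that derivative_outside_support unfolding K_def by blast
  have int: "integrable lborel (\<lambda>p. wave \<sigma> a g (fst p) (snd p) * frechet_derivative \<phi> (at p) v)"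
    if "locally_bounded g" "g \<in> borel_measurable borel" for a g v
    using wave_times_integrable[OF that K \<sigma> smooth_continuous_derivative[OF sm]] out by blast
  have distr: "regular_distr \<psi> (\<lambda>p. frechet_derivative \<phi> (at p) v) = c * (I a1 g1 v + I a2 g2 v)" for v
  proof -
    have [measurable]: "(\<lambda>p. frechet_derivative \<phi> (at p) v) \<in> borel_measurable borel"
      by (intro borel_measurable_continuous_onI smooth_continuous_derivative sm)
    have "regular_distr \<psi> (\<lambda>p. frechet_derivative \<phi> (at p) v)
        = (LINT p|lborel. \<psi> (fst p) (snd p) * frechet_derivative \<phi> (at p) v)"
      unfolding regular_distr_def set_lebesgue_integral_def
    proof (intro Bochner_Integration.integral_cong refl)
      fix p
      show "indicator half_plane p *\<^sub>R (\<psi> (fst p) (snd p) * frechet_derivative \<phi> (at p) v)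
          = \<psi> (fst p) (snd p) * frechet_derivative \<phi> (at p) v"
        using hp out[of p v] by (cases "p \<in> K") (auto simp: indicator_def)
    qed
    also have "\<dots> = (LINT p|lborel. c * (wave \<sigma> a1 g1 (fst p) (snd p) * frechet_derivative \<phi> (at p) v
        + wave \<sigma> a2 g2 (fst p) (snd p) * frechet_derivative \<phi> (at p) v))"
    proof (rule integral_cong_AE)
      show "AE p in lborel. \<psi> (fst p) (snd p) * frechet_derivative \<phi> (at p) v
        = c * (wave \<sigma> a1 g1 (fst p) (snd p) * frechet_derivative \<phi> (at p) v
          + wave \<sigma> a2 g2 (fst p) (snd p) * frechet_derivative \<phi> (at p) v)"
        using ae by eventually_elim (simp add: algebra_simps)
    qed measurable
    also have "\<dots> = c * (I a1 g1 v + I a2 g2 v)"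
      using int[OF g1, of a1 v] int[OF g2, of a2 v] by (simp add: I_def)
    finally show ?thesis .
  qed
  \<comment> \<open>By linearity the partial derivatives add up to the derivative in the
    characteristic direction \<open>(\<sigma>, 1)\<close>, to which
    \<open>integral_wave_transport\<close> applies.\<close>
  have combine: "I a g (0, 1) + of_real \<sigma> * I a g (1, 0) = - delta_source a g \<phi>"
    if g: "locally_bounded g" "g \<in> borel_measurable borel" for a g
  proof -
    have split: "frechet_derivative \<phi> (at p) (\<sigma>, 1)
        = frechet_derivative \<phi> (at p) (0, 1) + of_real \<sigma> * frechet_derivative \<phi> (at p) (1, 0)" for p
    proof -
      have lin: "linear (frechet_derivative \<phi> (at p))"
        using smooth_has_derivative[OF sm] by (rule has_derivative_linear)
      have "(\<sigma>, 1) = (0, 1) + \<sigma> *\<^sub>R (1, 0 :: real)" by simp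
      then show ?thesis
        by (simp only: linear_add[OF lin] linear_scale[OF lin] scaleR_conv_of_real)
    qed
    have "I a g (\<sigma>, 1) = (LINT p|lborel. wave \<sigma> a g (fst p) (snd p) * frechet_derivative \<phi> (at p) (0, 1)
        + of_real \<sigma> * (wave \<sigma> a g (fst p) (snd p) * frechet_derivative \<phi> (at p) (1, 0)))"
      unfolding I_def split by (simp add: algebra_simps)
    also have "\<dots> = I a g (0, 1) + of_real \<sigma> * I a g (1, 0)"
      using int[OF g, of a "(0, 1)"] int[OF g, of a "(1, 0)"] by (simp add: I_def)
    finally have "I a g (0, 1) + of_real \<sigma> * I a g (1, 0) = - (LINT s|lborel. g s * \<phi> (a, s))"
      using integral_wave_transport[OF sm K[unfolded K_def] g \<sigma>, of a] by (simp add: I_def)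
    also have "(LINT s|lborel. g s * \<phi> (a, s)) = delta_source a g \<phi>"
      unfolding delta_source_def set_lebesgue_integral_def
    proof (intro Bochner_Integration.integral_cong refl)
      fix s
      have "\<phi> (a, s) = 0" if "s \<le> 0"
        using that hp closure_subset[of "{p. \<phi> p \<noteq> 0}"] by (auto simp: K_def half_plane_def)
      then show "g s * \<phi> (a, s) = indicator {0<..} s *\<^sub>R (g s * \<phi> (a, s))"
        by (auto simp: indicator_def)
    qed
    finally show ?thesis .
  qed
  have "D_t (regular_distr \<psi>) \<phi> + of_real \<sigma> * D_x (regular_distr \<psi>) \<phi>
      = - c * ((I a1 g1 (0, 1) + of_real \<sigma> * I a1 g1 (1, 0))
               + (I a2 g2 (0, 1) + of_real \<sigma> * I a2 g2 (1, 0)))"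
    unfolding D_t_def D_x_def distr by (simp add: algebra_simps)
  then show "D_t (regular_distr \<psi>) \<phi> + of_real \<sigma> * D_x (regular_distr \<psi>) \<phi>
      = c * (delta_source a1 g1 \<phi> + delta_source a2 g2 \<phi>)"
    unfolding combine[OF g1] combine[OF g2] by (simp add: algebra_simps)
qed

section \<open>The explicit amplitudes\<close>

lemma e_minus_measurable [measurable]: "e_minus J0 \<Omega> L \<in> borel_measurable borel"
  unfolding e_minus_eq[abs_def] by measurable

lemma e_plus_measurable [measurable]: "e_plus J0 \<Omega> L \<in> borel_measurable borel"
  unfolding e_plus_eq[abs_def] by measurable

lemma locally_bounded_echo_sum:
  assumes "J0 > 0" and "L > 0"
  shows "locally_bounded (echo_sum J0 \<Omega> L p)"
  unfolding locally_bounded_def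
proof
  fix T :: real
  have "norm (echo_sum J0 \<Omega> L p s) \<le> exp (max T 0 * J0)" if "\<bar>s\<bar> \<le> T" for s
    using that by (intro norm_echo_sum_le assms) auto
  then show "\<exists>B. \<forall>s. \<bar>s\<bar> \<le> T \<longrightarrow> norm (echo_sum J0 \<Omega> L p s) \<le> B" by blast
qed

lemma locally_bounded_e:
  assumes "J0 > 0" and "L > 0"
  shows "locally_bounded (e_minus J0 \<Omega> L)" "locally_bounded (e_plus J0 \<Omega> L)"
  using locally_bounded_echo_sum[OF assms, of \<Omega> 0] locally_bounded_echo_sum[OF assms, of \<Omega> 1]
  by (simp_all add: locally_bounded_def e_minus_eq e_plus_eq)

lemma e_minus_neg: "L > 0 \<Longrightarrow> t < 0 \<Longrightarrow> e_minus J0 \<Omega> L t = 0"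
  by (simp add: e_minus_eq echo_sum_eq_0)

lemma e_plus_before: "L > 0 \<Longrightarrow> t < L \<Longrightarrow> e_plus J0 \<Omega> L t = 0"
  by (simp add: e_plus_eq echo_sum_eq_0)

text \<open>The first term has index 1 and starts from 0, so causality includes the end point
  \<open>t = L\<close>.\<close>

lemma e_plus_at_L: "L > 0 \<Longrightarrow> e_plus J0 \<Omega> L L = 0"
  using echo_sum_at_start[of L J0 \<Omega> 1] by (simp add: e_plus_eq)

text \<open>Until a round trip is completed, only the mode of index 0 has started: the qubit decays
  as if alone.\<close>

lemma e_minus_early:
  "L > 0 \<Longrightarrow> 0 \<le> t \<Longrightarrow> t < 2 * L \<Longrightarrow> e_minus J0 \<Omega> L t = damped_phase J0 \<Omega> t"
  using echo_sum_finite[of L t 1 0] by (simp add: e_minus_eq mode_def Theta_def)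

section \<open>The explicit fields as retarded waves\<close>

text \<open>This undoes the brackets in the outer regions of both fields, where one term of each
  qubit's wave has been merged.\<close>

lemma merge_consecutive_terms:
  fixes x :: real
  shows "x ^ m / fact (Suc m) * (x - real (Suc m)) = x ^ Suc m / fact (Suc m) - x ^ m / fact m"
proof -
  have "x ^ m / fact m = real (Suc m) * x ^ m / fact (Suc m)"
    by (simp add: divide_simps del: of_nat_Suc)
  then show ?thesis
    by (simp add: right_diff_distrib diff_divide_distrib ac_simps del: fact_Suc of_nat_Suc)
qed

text \<open>\<open>tau3\<close> and \<open>tau4\<close> coincide, so beyond the right qubit both
  waves share their delays. The conventions at the jumps agree too, hence no position is
  excluded.\<close>

lemma psi_R_eq:
  assumes "L > 0"
  shows "psi_R J0 \<Omega> L x t = - (\<i> * of_real (sqrt J0)) *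
    (wave 1 (- L / 2) (e_minus J0 \<Omega> L) x t + wave 1 (L / 2) (e_plus J0 \<Omega> L) x t)"
proof -
  let ?y = "t - (x + L / 2)" and ?z = "t - (x - L / 2)"
  have tau: "tau3 L n x t = ?y - real (2 * n + 0) * L" "tau4 L n x t = ?y - real (2 * n + 0) * L"
    "?z - real (2 * n + 1) * L = ?y - real (2 * n + 0) * L" for n
    by (simp_all add: tau3_def tau4_def algebra_simps)
  have split: "(\<tau> * J0) ^ (2 * n) / fact (2 * n + 1) * (\<tau> * J0 - (2 * real n + 1))
      = (\<tau> * J0) ^ (2 * n + 1) / fact (2 * n + 1) - (\<tau> * J0) ^ (2 * n) / fact (2 * n)" for n \<tau>
    using merge_consecutive_terms[of "\<tau> * J0" "2 * n"] by (simp add: add.commute)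
  have "(\<lambda>n. mode J0 \<Omega> (2 * n + 1) (?z - real (2 * n + 1) * L) * of_real (Theta (x - L / 2))
      - mode J0 \<Omega> (2 * n + 0) (?y - real (2 * n + 0) * L) * of_real (Theta (x + L / 2)))
    sums (echo_sum J0 \<Omega> L 1 ?z * of_real (Theta (x - L / 2))
      - echo_sum J0 \<Omega> L 0 ?y * of_real (Theta (x + L / 2)))"
    by (intro sums_diff sums_mult2 echo_sum_sums assms)
  \<comment> \<open>\<open>u\<close> and \<open>w\<close> are the cutoffs at the right and left
    qubit: the box \<open>w - u\<close> and the \<open>- b\<close> of the outer bracket together
    restore the full cutoff \<open>w\<close>.\<close>
  moreover have "of_real (a - b) * d * of_real (u * h) - of_real b * d * of_real ((w - u) * h)
      = of_real a * d * of_real h * of_real u - of_real b * d * of_real h * of_real w"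
    for a b u w h :: real and d :: complex
    by (simp add: algebra_simps)
  ultimately have "psi_R J0 \<Omega> L x t = \<i> * of_real (sqrt J0) *
     (echo_sum J0 \<Omega> L 1 ?z * of_real (Theta (x - L / 2))
      - echo_sum J0 \<Omega> L 0 ?y * of_real (Theta (x + L / 2)))"
    unfolding psi_R_def Let_def tau split Pi_box_def mode_def
    by (simp only: sums_iff add_0_right)
  then show ?thesis by (simp add: wave_def e_minus_eq e_plus_eq algebra_simps)
qed

text \<open>The qubit positions are excluded: with \<open>Theta 0 = 1\<close> the box contains its
  left end point but not its right one, opposite to what left-moving waves require.\<close>

lemma psi_L_eq:
  assumes "L > 0" and "x \<noteq> - L / 2" and "x \<noteq> L / 2"
  shows "psi_L J0 \<Omega> L x t = - (\<i> * of_real (sqrt J0)) *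
    (wave (-1) (- L / 2) (e_minus J0 \<Omega> L) x t + wave (-1) (L / 2) (e_plus J0 \<Omega> L) x t)"
proof -
  let ?y = "t + (x + L / 2)" and ?z = "t + (x - L / 2)"
  \<comment> \<open>The odd series renumbered so that its term \<open>n\<close> has the same delay
    as the even term \<open>n\<close>; the missing first term is 0.\<close>
  define late where
    "late n = (if n = 0 then 0 else mode J0 \<Omega> (2 * n - 1) (?y - real (2 * n) * L))" for n
  have tau: "tau6 L n x t = ?y - real (2 * n + 0) * L" "tau5 L n x t = ?z - real (2 * n + 1) * L" for n
    by (simp_all add: tau5_def tau6_def algebra_simps)
  \<comment> \<open>Left of both qubits both waves are present, between them only that of the right
    qubit, beyond them none.\<close>
  consider "x < - L / 2" | "- L / 2 < x" "x < L / 2" | "x > L / 2"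
    using assms by linarith
  then show ?thesis
  proof cases
    case 1
    have "(\<lambda>n. mode J0 \<Omega> (2 * n + 1) (?z - real (2 * n + 1) * L)) sums echo_sum J0 \<Omega> L 1 ?z"
      by (rule echo_sum_sums[OF assms(1)])
    also have "(\<lambda>n. mode J0 \<Omega> (2 * n + 1) (?z - real (2 * n + 1) * L)) = (\<lambda>n. late (Suc n))"
      by (auto simp: late_def algebra_simps)
    finally have "late sums echo_sum J0 \<Omega> L 1 ?z"
      by (subst (asm) sums_Suc_iff) (simp add: late_def)
    then have "(\<lambda>n. late n - mode J0 \<Omega> (2 * n + 0) (?y - real (2 * n + 0) * L))
        sums (echo_sum J0 \<Omega> L 1 ?z - echo_sum J0 \<Omega> L 0 ?y)"
      by (intro sums_diff echo_sum_sums assms)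
    \<comment> \<open>For \<open>n = 0\<close> the coefficient read as 1 leaves minus the even mode
      alone, in accordance with \<open>late 0 = 0\<close>.\<close>
    moreover have "- (of_real (if n = 0 then 1
                   else (\<tau> * J0) ^ (2 * n - 1) / fact (2 * n) * (\<tau> * J0 - 2 * real n))
          * damped_phase J0 \<Omega> \<tau> * of_real (Theta \<tau>))
       = late n - mode J0 \<Omega> (2 * n + 0) \<tau>" if "\<tau> = ?y - real (2 * n + 0) * L" for n \<tau>
    proof (cases n)
      case 0
      then show ?thesis by (simp add: late_def mode_def)
    next
      case (Suc k)
      have "(\<tau> * J0) ^ (2 * n - 1) / fact (2 * n) * (\<tau> * J0 - 2 * real n)
          = (\<tau> * J0) ^ (2 * n) / fact (2 * n) - (\<tau> * J0) ^ (2 * n - 1) / fact (2 * n - 1)"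
        using merge_consecutive_terms[of "\<tau> * J0" "2 * n - 1"] Suc by simp
      moreover have "late n = mode J0 \<Omega> (2 * n - 1) \<tau>"
        using that Suc by (simp add: late_def)
      ultimately show ?thesis
        using Suc unfolding mode_def by (simp add: left_diff_distrib del: power_Suc fact_Suc)
    qed
    ultimately have "psi_L J0 \<Omega> L x t
        = \<i> * of_real (sqrt J0) * (echo_sum J0 \<Omega> L 1 ?z - echo_sum J0 \<Omega> L 0 ?y)"
      unfolding psi_L_def Let_def tau using 1 assms
      by (simp add: Pi_box_def Theta_def[of "_ + L / 2"] Theta_def[of "_ - L / 2"] sums_iff)
    with 1 assms show ?thesis
      by (simp add: wave_def e_minus_eq e_plus_eq Theta_def algebra_simps)
  next
    case 2
    have "psi_L J0 \<Omega> L x t = \<i> * of_real (sqrt J0) * echo_sum J0 \<Omega> L 1 ?z"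
      unfolding psi_L_def Let_def tau echo_sum_def mode_def using 2 assms
      by (simp add: Pi_box_def Theta_def[of "x + L / 2"] Theta_def[of "x - L / 2"] Theta_def[of "- x - L / 2"])
    with 2 assms show ?thesis
      by (simp add: wave_def e_plus_eq Theta_def algebra_simps)
  next
    case 3
    then show ?thesis
      using assms by (simp add: psi_L_def wave_def Pi_box_def Theta_def)
  qed
qed

lemma psi_L_measurable: "(\<lambda>p. psi_L J0 \<Omega> L (fst p) (snd p)) \<in> borel_measurable borel"
  unfolding psi_L_def Let_def tau5_def tau6_def Pi_box_def borel_prod[symmetric]
  by measurable

lemma psi_R_measurable: "(\<lambda>p. psi_R J0 \<Omega> L (fst p) (snd p)) \<in> borel_measurable borel"
  unfolding psi_R_def Let_def tau3_def tau4_def Pi_box_def borel_prod[symmetric]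
  by measurable

section \<open>The field equations\<close>

lemma field_equations:
  assumes "J0 > 0" and "L > 0"
  shows "field_equation_L J0 L (e_amp J0 \<Omega> L) (psi_L J0 \<Omega> L)"
    and "field_equation_R J0 L (e_amp J0 \<Omega> L) (psi_R J0 \<Omega> L)"
proof -
  note lb = locally_bounded_e[OF assms, of \<Omega>]
  \<comment> \<open>The emission amplitude: multiplied by \<open>\<i>\<close> it becomes the
    coupling \<open>sqrt J0\<close>.\<close>
  let ?c = "- (\<i> * of_real (sqrt J0)) :: complex"
  let ?S = "\<lambda>\<phi>. delta_source (- L / 2) (e_minus J0 \<Omega> L) \<phi> + delta_source (L / 2) (e_plus J0 \<Omega> L) \<phi>"
  have S: "(\<Sum>Q\<in>{-1, 1}. delta_source (qubit_pos L Q) (e_amp J0 \<Omega> L Q) \<phi>) = ?S \<phi>" for \<phi>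
    by (simp add: e_amp_def qubit_pos_def)
  have c: "\<i> * (?c * z) = of_real (sqrt J0) * z" for z
    by (simp add: mult.assoc[symmetric])
  show "field_equation_L J0 L (e_amp J0 \<Omega> L) (psi_L J0 \<Omega> L)"
    unfolding field_equation_L_def S
  proof (intro conjI ballI)
    show "locally_integrable (psi_L J0 \<Omega> L)"
      by (rule emitted_field_equation(1)[OF _ lb(1) e_minus_measurable lb(2) e_plus_measurable
            psi_L_measurable psi_L_eq[OF assms(2)]]) simp_all
    fix \<phi> assume \<phi>: "\<phi> \<in> test_functions"
    have "D_t (regular_distr (psi_L J0 \<Omega> L)) \<phi> + of_real (-1) * D_x (regular_distr (psi_L J0 \<Omega> L)) \<phi>
        = ?c * ?S \<phi>"
      by (rule emitted_field_equation(2)[OF _ lb(1) e_minus_measurable lb(2) e_plus_measurable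
            psi_L_measurable psi_L_eq[OF assms(2)] \<phi>]) simp_all
    then have "D_t (regular_distr (psi_L J0 \<Omega> L)) \<phi> - D_x (regular_distr (psi_L J0 \<Omega> L)) \<phi> = ?c * ?S \<phi>"
      by simp
    then show "\<i> * (D_t (regular_distr (psi_L J0 \<Omega> L)) \<phi> - D_x (regular_distr (psi_L J0 \<Omega> L)) \<phi>)
        = of_real (sqrt J0) * ?S \<phi>"
      by (simp only: c)
  qed
  show "field_equation_R J0 L (e_amp J0 \<Omega> L) (psi_R J0 \<Omega> L)"
    unfolding field_equation_R_def S
  proof (intro conjI ballI)
    show "locally_integrable (psi_R J0 \<Omega> L)"
      by (rule emitted_field_equation(1)[OF _ lb(1) e_minus_measurable lb(2) e_plus_measurable
            psi_R_measurable psi_R_eq[OF assms(2)]]) simp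
    fix \<phi> assume \<phi>: "\<phi> \<in> test_functions"
    have "D_t (regular_distr (psi_R J0 \<Omega> L)) \<phi> + of_real 1 * D_x (regular_distr (psi_R J0 \<Omega> L)) \<phi>
        = ?c * ?S \<phi>"
      by (rule emitted_field_equation(2)[OF _ lb(1) e_minus_measurable lb(2) e_plus_measurable
            psi_R_measurable psi_R_eq[OF assms(2)] \<phi>]) simp
    then have "D_t (regular_distr (psi_R J0 \<Omega> L)) \<phi> + D_x (regular_distr (psi_R J0 \<Omega> L)) \<phi> = ?c * ?S \<phi>"
      by simp
    then show "\<i> * (D_t (regular_distr (psi_R J0 \<Omega> L)) \<phi> + D_x (regular_distr (psi_R J0 \<Omega> L)) \<phi>)
        = of_real (sqrt J0) * ?S \<phi>"
      by (simp only: c)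
  qed
qed

section \<open>The qubit equations\<close>

lemma e_minus_delay:
  assumes "L > 0" and "\<And>k. t \<noteq> real k * L"
  shows "(e_minus J0 \<Omega> L has_vector_derivative
    - of_real J0 * (e_minus J0 \<Omega> L t + e_plus J0 \<Omega> L (t - L)) - \<i> * of_real \<Omega> * e_minus J0 \<Omega> L t) (at t)"
  using echo_sum_delay_0[OF assms, of J0 \<Omega>]
  by (simp add: e_minus_eq[abs_def] e_plus_eq algebra_simps)

lemma e_plus_delay:
  assumes "L > 0" and "\<And>k. t \<noteq> real k * L"
  shows "(e_plus J0 \<Omega> L has_vector_derivative
    - of_real J0 * (e_minus J0 \<Omega> L (t - L) + e_plus J0 \<Omega> L t) - \<i> * of_real \<Omega> * e_plus J0 \<Omega> L t) (at t)"
  using echo_sum_delay_1[OF assms, of J0 \<Omega>, THEN has_vector_derivative_minus]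
  by (simp add: e_minus_eq e_plus_eq[abs_def] algebra_simps)

lemma isCont_e_minus: "L > 0 \<Longrightarrow> t \<noteq> 0 \<Longrightarrow> isCont (e_minus J0 \<Omega> L) t"
  using isCont_echo_sum[of L 0] by (simp add: e_minus_eq[abs_def])

lemma isCont_e_plus: "L > 0 \<Longrightarrow> isCont (e_plus J0 \<Omega> L) t"
  using isCont_echo_sum[of L 1 t] by (simp add: e_plus_eq[abs_def])

text \<open>The fields follow different formulas on the two sides of a qubit; each must extend
  continuously to it, with a common value.\<close>

lemma has_point_valueI:
  assumes "\<forall>\<^sub>F x in at_left a. f x = F x" "isCont F a" "F a = v"
    and "\<forall>\<^sub>F x in at_right a. f x = G x" "isCont G a" "G a = v"
  shows "has_point_value f a v"
  unfolding has_point_value_def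
proof
  have "(F \<longlongrightarrow> v) (at_left a)" "(G \<longlongrightarrow> v) (at_right a)"
    using assms by (auto simp: isCont_def intro: tendsto_within_subset)
  then show "(f \<longlongrightarrow> v) (at_left a)" "(f \<longlongrightarrow> v) (at_right a)"
    using assms by (auto simp: tendsto_cong)
qed

text \<open>The qubit's own radiation moves left on one side and right on the other, with equal
  limits; the partner's wave passes continuously. At time 0 \<open>e_minus\<close> jumps.\<close>

lemma point_value_left_qubit:
  assumes "L > 0" and "t \<noteq> 0"
  shows "has_point_value (\<lambda>x. psi_R J0 \<Omega> L x t + psi_L J0 \<Omega> L x t) (- L / 2)
    (- (\<i> * of_real (sqrt J0)) * (e_minus J0 \<Omega> L t + e_plus J0 \<Omega> L (t - L)))"
proof (rule has_point_valueI)
  let ?c = "- (\<i> * of_real (sqrt J0)) :: complex"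
  let ?em = "e_minus J0 \<Omega> L" and ?ep = "e_plus J0 \<Omega> L"
  let ?F = "\<lambda>x. ?c * (?em (t + (x + L / 2)) + ?ep (t + (x - L / 2)))"
  let ?G = "\<lambda>x. ?c * (?em (t - (x + L / 2)) + ?ep (t + (x - L / 2)))"
  have "\<forall>\<^sub>F x in at_left (- L / 2). x < - L / 2" by (simp add: eventually_at_filter)
  then show "\<forall>\<^sub>F x in at_left (- L / 2). psi_R J0 \<Omega> L x t + psi_L J0 \<Omega> L x t = ?F x"
    by eventually_elim
       (use assms in \<open>simp add: psi_R_eq psi_L_eq wave_def Theta_def algebra_simps\<close>)
  have "\<forall>\<^sub>F x in at_right (- L / 2). x \<in> {- L / 2<..<L / 2}"
    using assms by (intro eventually_at_right_real) simp
  then show "\<forall>\<^sub>F x in at_right (- L / 2). psi_R J0 \<Omega> L x t + psi_L J0 \<Omega> L x t = ?G x"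
    by eventually_elim
       (use assms in \<open>simp add: psi_R_eq psi_L_eq wave_def Theta_def algebra_simps\<close>)
  show "isCont ?F (- L / 2)" "isCont ?G (- L / 2)"
    using assms by (auto intro!: continuous_intros isCont_o2[OF _ isCont_e_minus] isCont_o2[OF _ isCont_e_plus])
qed (simp_all add: algebra_simps)

text \<open>The excluded time is now \<open>L\<close>, when the front created by the jump of
  \<open>e_minus\<close> arrives.\<close>

lemma point_value_right_qubit:
  assumes "L > 0" and "t \<noteq> L"
  shows "has_point_value (\<lambda>x. psi_R J0 \<Omega> L x t + psi_L J0 \<Omega> L x t) (L / 2)
    (- (\<i> * of_real (sqrt J0)) * (e_minus J0 \<Omega> L (t - L) + e_plus J0 \<Omega> L t))"
proof (rule has_point_valueI)
  let ?c = "- (\<i> * of_real (sqrt J0)) :: complex"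
  let ?em = "e_minus J0 \<Omega> L" and ?ep = "e_plus J0 \<Omega> L"
  let ?F = "\<lambda>x. ?c * (?em (t - (x + L / 2)) + ?ep (t + (x - L / 2)))"
  let ?G = "\<lambda>x. ?c * (?em (t - (x + L / 2)) + ?ep (t - (x - L / 2)))"
  have "\<forall>\<^sub>F x in at_left (L / 2). x \<in> {- L / 2<..<L / 2}"
    using assms by (intro eventually_at_left_real) simp
  then show "\<forall>\<^sub>F x in at_left (L / 2). psi_R J0 \<Omega> L x t + psi_L J0 \<Omega> L x t = ?F x"
    by eventually_elim
       (use assms in \<open>simp add: psi_R_eq psi_L_eq wave_def Theta_def algebra_simps\<close>)
  have "\<forall>\<^sub>F x in at_right (L / 2). x > L / 2" by (simp add: eventually_at_filter)
  then show "\<forall>\<^sub>F x in at_right (L / 2). psi_R J0 \<Omega> L x t + psi_L J0 \<Omega> L x t = ?G x"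
    by eventually_elim
       (use assms in \<open>simp add: psi_R_eq psi_L_eq wave_def Theta_def algebra_simps\<close>)
  show "isCont ?F (L / 2)" "isCont ?G (L / 2)"
    using assms by (auto intro!: continuous_intros isCont_o2[OF _ isCont_e_minus] isCont_o2[OF _ isCont_e_plus])
qed (simp_all add: algebra_simps)

lemma AE_not_multiple:
  fixes L :: real
  shows "AE t in lborel. \<forall>k. t \<noteq> real k * L"
proof -
  have "range (\<lambda>k. real k * L) \<in> null_sets lborel"
    by (intro countable_imp_null_set_lborel) auto
  from AE_not_in[OF this] show ?thesis by eventually_elim auto
qed

text \<open>The qubit's own field supplies the decay \<open>J0\<close>, the partner's the delayed
  coupling, so the delay equation is the qubit equation off the multiples of
  \<open>L\<close>.\<close>

lemma qubit_equations:
  assumes "J0 > 0" and "L > 0" and "Q \<in> {-1, 1}"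
  shows "qubit_equation J0 \<Omega> L (e_amp J0 \<Omega> L) (psi_L J0 \<Omega> L) (psi_R J0 \<Omega> L) Q"
proof -
  have sq: "of_real (sqrt J0) * (- (\<i> * of_real (sqrt J0)) * z) = - (\<i> * of_real J0 * z)" for z :: complex
  proof -
    have "of_real (sqrt J0) * of_real (sqrt J0) = (of_real J0 :: complex)"
      using assms by (simp flip: of_real_mult)
    moreover have "a * (- (\<i> * a) * z) = - (\<i> * (a * a) * z)" for a :: complex
      by (simp add: ac_simps)
    ultimately show ?thesis by simp
  qed
  have ii: "\<i> * (\<i> * z) = - z" for z
    by (simp add: mult.assoc[symmetric])
  have sol: "\<i> * (- of_real J0 * y - \<i> * of_real \<Omega> * e) - of_real \<Omega> * e
      = of_real (sqrt J0) * (- (\<i> * of_real (sqrt J0)) * y)" for y e :: complex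
    unfolding sq by (simp add: algebra_simps ii)
  have cont: "continuous_on {0<..} (e_amp J0 \<Omega> L Q)"
    using assms isCont_e_minus[OF assms(2)] isCont_e_plus[OF assms(2)]
    by (auto simp: e_amp_def intro!: continuous_at_imp_continuous_on)
  have "AE t in lborel. t > 0 \<longrightarrow>
        (\<exists>e' v. (e_amp J0 \<Omega> L Q has_vector_derivative e') (at t) \<and>
                has_point_value (\<lambda>x. psi_R J0 \<Omega> L x t + psi_L J0 \<Omega> L x t) (qubit_pos L Q) v \<and>
                \<i> * e' - of_real \<Omega> * e_amp J0 \<Omega> L Q t = of_real (sqrt J0) * v)"
    using AE_not_multiple[of L]
  proof eventually_elim
    case (elim t)
    have t: "t \<noteq> real k * L" for k using elim by blast
    \<comment> \<open>The multiples \<open>k = 0\<close> and \<open>k = 1\<close> are the times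
      excluded in the two point values.\<close>
    from t[of 0] t[of 1] have "t \<noteq> 0" "t \<noteq> L" by auto
    consider "Q = -1" | "Q = 1" using assms(3) by blast
    then show ?case
    proof cases
      case 1
      have eqs: "e_amp J0 \<Omega> L Q = e_minus J0 \<Omega> L" "qubit_pos L Q = - L / 2"
        by (simp_all add: 1 e_amp_def qubit_pos_def)
      show ?thesis
        unfolding eqs
        by (intro impI exI conjI, rule e_minus_delay[OF assms(2) t],
            rule point_value_left_qubit[OF assms(2) \<open>t \<noteq> 0\<close>], rule sol)
    next
      case 2
      have eqs: "e_amp J0 \<Omega> L Q = e_plus J0 \<Omega> L" "qubit_pos L Q = L / 2"
        by (simp_all add: 2 e_amp_def qubit_pos_def)
      show ?thesis
        unfolding eqs
        by (intro impI exI conjI, rule e_plus_delay[OF assms(2) t],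
            rule point_value_right_qubit[OF assms(2) \<open>t \<noteq> L\<close>], rule sol)
    qed
  qed
  with cont show ?thesis unfolding qubit_equation_def by blast
qed

section \<open>Continuous attainment of the initial state\<close>

text \<open>Before time \<open>L\<close> only qubit -1 has radiated, so the field lives in its light
  cone; the constant is \<open>norm_echo_sum_le\<close> with \<open>T = L\<close>.\<close>

lemma field_energy_density_early:
  assumes "J0 > 0" and "L > 0" and "0 < t" and "t < L" and "x \<noteq> - L / 2" and "x \<noteq> L / 2"
  shows "(cmod (psi_L J0 \<Omega> L x t))\<^sup>2 + (cmod (psi_R J0 \<Omega> L x t))\<^sup>2
    \<le> J0 * (exp (L * J0))\<^sup>2 * indicator {- L / 2 - t..- L / 2 + t} x"
proof -
  have bnd: "(cmod (\<i> * of_real (sqrt J0) * e_minus J0 \<Omega> L s))\<^sup>2 \<le> J0 * (exp (L * J0))\<^sup>2" if "s \<le> L" for s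
  proof -
    have "cmod (e_minus J0 \<Omega> L s) \<le> exp (L * J0)"
      unfolding e_minus_eq using that assms by (intro norm_echo_sum_le) auto
    then have "(cmod (e_minus J0 \<Omega> L s))\<^sup>2 \<le> (exp (L * J0))\<^sup>2"
      by (intro power_mono) auto
    then show ?thesis using assms by (simp add: norm_mult power_mult_distrib)
  qed
  \<comment> \<open>The regions are cut out by the light-cone edges and the qubits; for
    \<open>t < L\<close> the right edge has not reached qubit 1.\<close>
  consider "x < - L / 2 - t" | "- L / 2 - t \<le> x" "x < - L / 2" | "- L / 2 < x" "x \<le> - L / 2 + t"
    | "- L / 2 + t < x" "x < L / 2" | "x > L / 2"
    using assms by linarith
  then show ?thesis
  proof cases
    case 1
    then show ?thesis using assms
      by (simp add: psi_R_eq psi_L_eq wave_def Theta_def e_minus_neg e_plus_before)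
  next
    case 2
    then show ?thesis using assms bnd[of "t - (- x - L / 2)"]
      by (simp add: psi_R_eq psi_L_eq wave_def Theta_def e_plus_before)
  next
    case 3
    then show ?thesis using assms bnd[of "t - (x + L / 2)"]
      by (simp add: psi_R_eq psi_L_eq wave_def Theta_def e_plus_before)
  next
    case 4
    then show ?thesis using assms
      by (simp add: psi_R_eq psi_L_eq wave_def Theta_def e_minus_neg e_plus_before)
  next
    case 5
    then show ?thesis using assms
      by (simp add: psi_R_eq psi_L_eq wave_def Theta_def e_minus_neg e_plus_before)
  qed
qed

text \<open>The light cone has width \<open>2 * t\<close>; the second summand is the deviation of
  the freely decaying qubit from 1.\<close>

lemma dist2_early:
  assumes "J0 > 0" and "L > 0" and "0 < t" and "t < L"
  shows "dist2_excited (-1) (e_amp J0 \<Omega> L) (psi_L J0 \<Omega> L) (psi_R J0 \<Omega> L) t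
    \<le> ennreal (J0 * (exp (L * J0))\<^sup>2 * (2 * t) + (cmod (damped_phase J0 \<Omega> t - 1))\<^sup>2)"
proof -
  let ?C = "J0 * (exp (L * J0))\<^sup>2"
  have "AE x in lborel. x \<noteq> - L / 2 \<and> x \<noteq> L / 2"
    using AE_lborel_singleton[of "- L / 2"] AE_lborel_singleton[of "L / 2"] by eventually_elim simp
  then have "(\<integral>\<^sup>+x. ennreal ((cmod (psi_L J0 \<Omega> L x t))\<^sup>2 + (cmod (psi_R J0 \<Omega> L x t))\<^sup>2) \<partial>lborel)
     \<le> (\<integral>\<^sup>+x. ennreal ?C * indicator {- L / 2 - t..- L / 2 + t} x \<partial>lborel)"
  proof (intro nn_integral_mono_AE, eventually_elim)
    case (elim x)
    then have "ennreal ((cmod (psi_L J0 \<Omega> L x t))\<^sup>2 + (cmod (psi_R J0 \<Omega> L x t))\<^sup>2)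
        \<le> ennreal (?C * indicator {- L / 2 - t..- L / 2 + t} x)"
      using assms by (intro ennreal_leI field_energy_density_early) auto
    then show ?case
      using assms by (simp add: ennreal_mult ennreal_indicator)
  qed
  also have "\<dots> = ennreal (?C * (2 * t))"
    using assms by (simp add: nn_integral_cmult_indicator ennreal_mult)
  finally have "dist2_excited (-1) (e_amp J0 \<Omega> L) (psi_L J0 \<Omega> L) (psi_R J0 \<Omega> L) t
    \<le> ennreal (?C * (2 * t)) + ennreal ((cmod (damped_phase J0 \<Omega> t - 1))\<^sup>2)"
    unfolding dist2_excited_def using assms
    by (intro add_mono) (auto simp: e_amp_def e_minus_early e_plus_before)
  then show ?thesis using assms by (simp add: ennreal_plus)
qed

lemma initial_state:
  assumes "J0 > 0" and "L > 0"
  shows "initially_excited (-1) (e_amp J0 \<Omega> L) (psi_L J0 \<Omega> L) (psi_R J0 \<Omega> L)"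
  unfolding initially_excited_def
proof (intro conjI)
  show "\<forall>Q\<in>{-1, 1}. e_amp J0 \<Omega> L Q 0 = (if Q = -1 then 1 else 0)"
    using assms by (simp add: e_amp_def e_minus_early e_plus_before damped_phase_def)
  \<comment> \<open>Only almost everywhere: with \<open>Theta 0 = 1\<close> the right-moving field
    is non-zero at \<open>x = - L / 2\<close>.\<close>
  show "AE x in lborel. psi_L J0 \<Omega> L x 0 = 0 \<and> psi_R J0 \<Omega> L x 0 = 0"
    using AE_lborel_singleton[of "- L / 2"] AE_lborel_singleton[of "L / 2"]
    by eventually_elim
       (use assms in \<open>auto simp: psi_L_eq psi_R_eq wave_def Theta_def e_minus_neg e_plus_before\<close>)
  \<comment> \<open>The bound of \<open>dist2_early\<close>, continuous and zero at time 0.\<close>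
  let ?u = "\<lambda>t. J0 * (exp (L * J0))\<^sup>2 * (2 * t) + (cmod (damped_phase J0 \<Omega> t - 1))\<^sup>2"
  have "isCont ?u 0"
    unfolding damped_phase_def by (intro continuous_intros)
  then have "(?u \<longlongrightarrow> ?u 0) (at_right 0)"
    unfolding isCont_def by (rule tendsto_within_subset) simp
  then have u: "(?u \<longlongrightarrow> 0) (at_right 0)"
    by (simp add: damped_phase_def)
  have lim: "((\<lambda>t. ennreal (?u t)) \<longlongrightarrow> 0) (at_right 0)"
    using tendsto_ennrealI[OF u] by simp
  show "(dist2_excited (-1) (e_amp J0 \<Omega> L) (psi_L J0 \<Omega> L) (psi_R J0 \<Omega> L) \<longlongrightarrow> 0) (at_right 0)"
  proof (rule tendsto_sandwich[OF _ _ tendsto_const lim])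
    have "\<forall>\<^sub>F t in at_right 0. t \<in> {0<..<L}"
      using assms by (intro eventually_at_right_real)
    then show "\<forall>\<^sub>F t in at_right 0.
        dist2_excited (-1) (e_amp J0 \<Omega> L) (psi_L J0 \<Omega> L) (psi_R J0 \<Omega> L) t \<le> ennreal (?u t)"
      by eventually_elim (rule dist2_early, use assms in auto)
  qed simp
qed

theorem mainTheorem2:
  fixes J0 \<Omega> L :: real
  assumes "J0 > 0" and "\<Omega> > 0" and "L > 0"
  shows "initially_excited (-1) (e_amp J0 \<Omega> L) (psi_L J0 \<Omega> L) (psi_R J0 \<Omega> L) \<and>
    field_equation_L J0 L (e_amp J0 \<Omega> L) (psi_L J0 \<Omega> L) \<and>
    field_equation_R J0 L (e_amp J0 \<Omega> L) (psi_R J0 \<Omega> L) \<and>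
    (\<forall>Q\<in>{-1, 1}. qubit_equation J0 \<Omega> L (e_amp J0 \<Omega> L) (psi_L J0 \<Omega> L) (psi_R J0 \<Omega> L) Q) \<and>
    (\<forall>t. 0 \<le> t \<and> t \<le> L \<longrightarrow> e_amp J0 \<Omega> L 1 t = 0)"
proof (intro conjI)
  show "\<forall>t. 0 \<le> t \<and> t \<le> L \<longrightarrow> e_amp J0 \<Omega> L 1 t = 0"
  proof (intro allI impI)
    fix t assume "0 \<le> t \<and> t \<le> L"
    \<comment> \<open>\<open>e_plus_before\<close> is strict, so \<open>t = L\<close> is treated
      apart.\<close>
    then show "e_amp J0 \<Omega> L 1 t = 0"
      using assms by (cases "t = L") (auto simp: e_amp_def e_plus_before e_plus_at_L)
  qed
qed (use assms initial_state[of J0 L \<Omega>] field_equations[of J0 L \<Omega>]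
      qubit_equations[of J0 L _ \<Omega>] in simp_all)

end
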